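(* Each of the following six "generalised bunkbed statements" is false; that is, for each of the six percolation models $\mathcal{E}$ listed in the context there exist a structure $Q$ of the appropriate kind (together with the required auxiliary sets $T$, and $F$ where applicable) and vertices $u,v\in V(Q)$ such that $$\Pr\bigl(u^{(0)}\to v^{(0)}\bigr)<\Pr\bigl(u^{(0)}\to v^{(1)}\bigr),$$ where $x\to y$ denotes the event that the retained edges contain a path from $x$ to $y$ (a directed path in the digraph cases), and the random set of retained edges is chosen uniformly from $\mathcal{E}(\tilde Q)$: (1) model $E_1$ on some finite simple graph $G$; (2) model $E_2^T$ on some finite simple graph $G$ and some $T\subseteq V(G)$; (3) model $E_4^T$ on some finite hypergraph $\mathcal{H}$ and some $T\subseteq V(\mathcal{H})$; (4) model $E_5$ on some finite hypergraph $\mathcal{H}$; (5) model $E_6^{T,F}$ on some finite digraph $D$, some $T\subseteq V(D)$ and some $F\subseteq E(D)$; (6) model $E_7$ on some finite directed multigraph $D$.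
   Context: Bunkbed structure: for $Q$ a graph, hypergraph, or (multi)digraph, $\tilde Q$ is formed by taking two copies $Q_0$ (lower bunk) and $Q_1$ (upper bunk) of $Q$, writing $v^{(i)}$ and $e^{(i)}$ for the copies of vertex $v$ and edge $e$ in $Q_i$ (the edges $e^{(i)}$ are called horizontal), and adding for each $v\in V(Q)$ a vertical edge $v^{(0)}v^{(1)}$ (an ordinary 2-element edge; in the directed cases it is bidirectional, i.e. can be traversed in both directions). A percolation model $\mathcal{E}(\tilde Q)$ is a family of subsets of $E(\tilde Q)$; one picks $X\in\mathcal{E}(\tilde Q)$ uniformly at random and retains exactly the edges in $X$. In a hypergraph, a path is a sequence of vertices in which consecutive vertices lie together in some retained hyperedge. The models: $E_1$ (graph $G$): a set $U\subseteq V(\tilde G)$ of open vertices is chosen uniformly among all subsets of $V(\tilde G)$, and exactly the edges of $\tilde G$ with both endpoints in $U$ are retained. $E_2^T$ (graph $G$, $T\subseteq V(G)$): the open set $U\subseteq V(\tilde G)$ is chosen uniformly among all sets such that for $v\in T$ both $v^{(0)},v^{(1)}\in U$, and for $v\notin T$ exactly one of $v^{(0)},v^{(1)}$ is in $U$; exactly the edges with both endpoints in $U$ are retained. $E_4^T$ (hypergraph $\mathcal{H}$, $T\subseteq V(\mathcal{H})$): the family of all $X\subseteq E(\tilde{\mathcal{H}})$ containing exactly one of $e^{(0)},e^{(1)}$ for each $e\in E(\mathcal{H})$, and containing exactly those vertical edges $v^{(0)}v^{(1)}$ with $v\in T$. $E_5$ (hypergraph $\mathcal{H}$): all subsets of $E(\tilde{\mathcal{H}})$.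 $E_6^{T,F}$ (digraph $D$, $T\subseteq V(D)$, $F\subseteq E(D)$): the family of all $X\subseteq E(\tilde D)$ containing both $e^{(0)}$ and $e^{(1)}$ for every $e\in F$, exactly one of $e^{(0)},e^{(1)}$ for every $e\in E(D)\setminus F$, and exactly those vertical edges $v^{(0)}v^{(1)}$ with $v\in T$. $E_7$ (directed multigraph $D$): all subsets of $E(\tilde D)$. *)

theory Defs
  imports "HOL-Probability.Probability" "Graph_Theory.Digraph"
begin

section \<open>Graphs and hypergraphs\<close>

text \<open>
  Hypergraphs are pairs of a vertex set and a set of non-empty hyperedges, so there are no repeated
  hyperedges; the members of a simple graph's edge set are two-element sets.
\<close>

definition finite_hypergraph :: "'v set \<Rightarrow> 'v set set \<Rightarrow> bool" where
  "finite_hypergraph V E \<longleftrightarrow> finite V \<and> (\<forall>e\<in>E. e \<subseteq> V \<and> e \<noteq> {})"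

definition finite_simple_graph :: "'v set \<Rightarrow> 'v set set \<Rightarrow> bool" where
  "finite_simple_graph V E \<longleftrightarrow> finite V \<and> (\<forall>e\<in>E. e \<subseteq> V \<and> card e = 2)"

section \<open>Bunkbeds\<close>

datatype bunk = Lower | Upper

definition bunkbed_verts :: "'v set \<Rightarrow> ('v \<times> bunk) set" where
  "bunkbed_verts V = V \<times> {Lower, Upper}"

definition horizontal :: "bunk \<Rightarrow> 'v set \<Rightarrow> ('v \<times> bunk) set" where
  "horizontal i e = (\<lambda>v. (v, i)) ` e"

definition vertical :: "'v \<Rightarrow> ('v \<times> bunk) set" where
  "vertical v = {(v, Lower), (v, Upper)}"

text \<open>
  For non-empty hyperedges the sets below are pairwise distinct, so identifying an edge of the
  bunkbed with its set of ends loses nothing.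
\<close>

definition bunkbed_edges :: "'v set \<Rightarrow> 'v set set \<Rightarrow> ('v \<times> bunk) set set" where
  "bunkbed_edges V E = horizontal Lower ` E \<union> horizontal Upper ` E \<union> vertical ` V"

text \<open>
  In a bunkbed over a digraph, arcs are named (the digraph may have parallel arcs). A vertical edge is
  a single edge that is retained or deleted as a whole, although it can be used in both directions.
\<close>

datatype ('v, 'a) bunkbed_arc = Horizontal bunk 'a | Vertical 'v

definition bunkbed_arcs :: "('v, 'a) pre_digraph \<Rightarrow> ('v, 'a) bunkbed_arc set" where
  "bunkbed_arcs D =
     Horizontal Lower ` arcs D \<union> Horizontal Upper ` arcs D \<union> Vertical ` verts D"

section \<open>Paths in the retained edges\<close>

definition path_between :: "('p \<Rightarrow> 'p \<Rightarrow> bool) \<Rightarrow> 'p \<Rightarrow> 'p \<Rightarrow> bool" where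
  "path_between R x y \<longleftrightarrow> (\<exists>p. p \<noteq> [] \<and> hd p = x \<and> last p = y \<and> successively R p)"

lemma path_between_iff_rtranclp: "path_between R x y \<longleftrightarrow> R\<^sup>*\<^sup>* x y"
proof
  assume "path_between R x y"
  then obtain p where "p \<noteq> []" "hd p = x" "last p = y" "successively R p"
    unfolding path_between_def by blast
  then show "R\<^sup>*\<^sup>* x y"
  proof (induction p arbitrary: x)
    case (Cons a p)
    then show ?case
      by (cases p) (auto intro: converse_rtranclp_into_rtranclp)
  qed simp
next
  assume "R\<^sup>*\<^sup>* x y"
  then show "path_between R x y"
  proof (induction rule: converse_rtranclp_induct)
    case base
    show ?case unfolding path_between_def by (intro exI[of _ "[y]"]) simp
  next
    case (step x z)
    then obtain p where "p \<noteq> []" "hd p = z" "last p = y" "successively R p"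
      unfolding path_between_def by blast
    with step.hyps(1) show ?case
      unfolding path_between_def by (intro exI[of _ "x # p"]) (cases p; simp)
  qed
qed

definition connects :: "'p set set \<Rightarrow> 'p \<Rightarrow> 'p \<Rightarrow> bool" where
  "connects X = path_between (\<lambda>x y. \<exists>e\<in>X. x \<in> e \<and> y \<in> e)"

definition arc_step ::
    "('v, 'a) pre_digraph \<Rightarrow> ('v, 'a) bunkbed_arc set \<Rightarrow> 'v \<times> bunk \<Rightarrow> 'v \<times> bunk \<Rightarrow> bool" where
  "arc_step D X x y \<longleftrightarrow>
     (\<exists>i a. Horizontal i a \<in> X \<and> x = (tail D a, i) \<and> y = (head D a, i)) \<or>
     (\<exists>v. Vertical v \<in> X \<and>
        (x = (v, Lower) \<and> y = (v, Upper) \<or> x = (v, Upper) \<and> y = (v, Lower)))"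

definition diconnects ::
    "('v, 'a) pre_digraph \<Rightarrow> ('v, 'a) bunkbed_arc set \<Rightarrow> 'v \<times> bunk \<Rightarrow> 'v \<times> bunk \<Rightarrow> bool" where
  "diconnects D X = path_between (arc_step D X)"

section \<open>Percolation models\<close>

text \<open>
  Each model is the distribution of the random set of retained edges. In \<open>E1\<close> and \<open>E2\<close> it is the
  set of open vertices, not the set of retained edges, that is uniformly distributed.
\<close>

definition retained_edges :: "'p set set \<Rightarrow> 'p set \<Rightarrow> 'p set set" where
  "retained_edges E U = {e \<in> E. e \<subseteq> U}"

definition E1 :: "'v set \<Rightarrow> 'v set set \<Rightarrow> ('v \<times> bunk) set set pmf" where
  "E1 V E = map_pmf (retained_edges (bunkbed_edges V E)) (pmf_of_set (Pow (bunkbed_verts V)))"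

definition E2 :: "'v set \<Rightarrow> 'v set set \<Rightarrow> 'v set \<Rightarrow> ('v \<times> bunk) set set pmf" where
  "E2 V E T = map_pmf (retained_edges (bunkbed_edges V E))
     (pmf_of_set {U. U \<subseteq> bunkbed_verts V \<and>
        (\<forall>v\<in>T. (v, Lower) \<in> U \<and> (v, Upper) \<in> U) \<and>
        (\<forall>v\<in>V - T. (v, Lower) \<in> U \<longleftrightarrow> (v, Upper) \<notin> U)})"

definition E4 :: "'v set \<Rightarrow> 'v set set \<Rightarrow> 'v set \<Rightarrow> ('v \<times> bunk) set set pmf" where
  "E4 V E T = pmf_of_set {X. X \<subseteq> bunkbed_edges V E \<and>
     (\<forall>e\<in>E. horizontal Lower e \<in> X \<longleftrightarrow> horizontal Upper e \<notin> X) \<and>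
     (\<forall>v\<in>V. vertical v \<in> X \<longleftrightarrow> v \<in> T)}"

definition E5 :: "'v set \<Rightarrow> 'v set set \<Rightarrow> ('v \<times> bunk) set set pmf" where
  "E5 V E = pmf_of_set (Pow (bunkbed_edges V E))"

definition E6 ::
    "('v, 'a) pre_digraph \<Rightarrow> 'v set \<Rightarrow> 'a set \<Rightarrow> ('v, 'a) bunkbed_arc set pmf" where
  "E6 D T F = pmf_of_set {X. X \<subseteq> bunkbed_arcs D \<and>
     (\<forall>a\<in>F. Horizontal Lower a \<in> X \<and> Horizontal Upper a \<in> X) \<and>
     (\<forall>a\<in>arcs D - F. Horizontal Lower a \<in> X \<longleftrightarrow> Horizontal Upper a \<notin> X) \<and>
     (\<forall>v\<in>verts D. Vertical v \<in> X \<longleftrightarrow> v \<in> T)}"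

definition E7 :: "('v, 'a) pre_digraph \<Rightarrow> ('v, 'a) bunkbed_arc set pmf" where
  "E7 D = pmf_of_set (Pow (bunkbed_arcs D))"

end

theory Submission
  imports Defs
begin

text \<open>
  All six counterexamples contain the same chain of sites. A site (a vertex, hyperedge or arc of the
  structure) is retained on some set of the two levels. Two neighbouring sites are joined if they
  share a level, and certain further pairs of sites are tied together by hubs whose two copies are
  connected with each other. If some site is retained on no level or on both, or if some joint
  carries a vertical edge, then flipping all levels beyond that place preserves the joints and swaps the two
  target levels. So only the configurations in which every site has exactly one level
  contribute to the difference of the two probabilities, and among these the upper target wins, 13 to
  12.

  In the models \<open>E1\<close>, \<open>E5\<close> and \<open>E7\<close> nothing can be prescribed, so everything the chain needs besides
  its sites is supplied in \<open>m\<close> disjoint copies: for large \<open>m\<close> one copy is completely retained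
  with probability close to 1.
\<close>

section \<open>Chains of sites\<close>

text \<open>When every site has one level, the levels are determined by the pattern of intact and
  broken joints, and the number of broken joints is even for the lower target and odd for the upper
  one. So the difference of the two counts is the sum of (-1)^(number of broken joints) over the
  connecting patterns. The three groups of hubs form a triangle: side 02 is one joint, sides 01 and
  12 are two parallel joints each. If joint 02 is intact, the other four are free and the sum
  cancels. If it is broken, this gives a factor -1, and each doubled side, having to keep at least
  one of its two joints, gives 1 - 1 - 1 = -1. The total is -1. There are 16 + 9 = 25 connecting
  patterns, hence 12 against 13. The sides are doubled because the chain has to run through all
  joints in one trail from group 0 to group 2, so these two groups need odd degree; the trail is 0 1
  0 2 1 2.\<close>

fun flip :: "bunk \<Rightarrow> bunk" where
  "flip Lower = Upper"
| "flip Upper = Lower"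

lemma flip_flip [simp]: "flip (flip s) = s"
  by (cases s) auto

lemma UNIV_bunk: "UNIV = {Lower, Upper}"
  using bunk.exhaust by auto

lemma finite_UNIV_bunk [simp]: "finite (UNIV :: bunk set)"
  by (simp add: UNIV_bunk)

lemma all_bunk: "(\<forall>s. P s) \<longleftrightarrow> P Lower \<and> P Upper"
  by (metis bunk.exhaust)

lemma flip_image_UNIV [simp]: "flip ` UNIV = UNIV"
  by (auto simp: UNIV_bunk)

lemma mem_flip_image: "s \<in> flip ` A \<longleftrightarrow> flip s \<in> A"
  by (metis flip_flip imageE imageI)

text \<open>
  \<open>S i\<close> is the set of levels on which site \<open>i\<close> is retained, and \<open>j i\<close> says that a vertical edge links the
  two levels between the sites \<open>i\<close> and \<open>i + 1\<close>.
\<close>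

definition joined :: "(nat \<Rightarrow> bunk set) \<Rightarrow> (nat \<Rightarrow> bool) \<Rightarrow> nat \<Rightarrow> bool" where
  "joined S j i \<longleftrightarrow> S i \<inter> S (Suc i) \<noteq> {} \<or> j i \<and> S i \<noteq> {} \<and> S (Suc i) \<noteq> {}"

text \<open>The two sites at a joint other than \<open>c\<close> are flipped together or not at all.
  At \<open>c\<close> only the site beyond is flipped, but with a link, or with \<open>S c\<close>
  empty or full, being joined there depends only on which of the two sites are non-empty, and this
  survives a flip.\<close>

lemma joined_flip:
  assumes "j c \<or> S c = {} \<or> S c = UNIV"
  shows "joined (\<lambda>i. if c < i then flip ` S i else S i) j = joined S j"
proof
  fix i
  have inv: "flip ` A \<inter> flip ` B = flip ` (A \<inter> B)" for A B
    by (metis flip_flip image_Int inj_def)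
  consider "i < c" | "i = c" | "c < i" by linarith
  then show "joined (\<lambda>i. if c < i then flip ` S i else S i) j i = joined S j i"
  proof cases
    case 2
    with assms show ?thesis by (auto simp: joined_def)
  qed (auto simp: joined_def inv simp del: Int_iff)
qed

section \<open>Reflecting a configuration beyond a cut\<close>

definition sites :: "nat \<Rightarrow> (nat \<times> bunk) set" where
  "sites n = {1..n} \<times> UNIV"

lemma finite_sites [simp]: "finite (sites n)"
  by (simp add: sites_def)

lemma card_sites: "card (sites n) = 2 * n"
  by (simp add: sites_def UNIV_bunk card_cartesian_product)

text \<open>The two virtual sites \<open>0\<close> and \<open>n + 1\<close> carry the levels of the two ends of a connection.\<close>

definition levels :: "nat \<Rightarrow> (nat \<times> bunk) set \<Rightarrow> bunk \<Rightarrow> nat \<Rightarrow> bunk set" where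
  "levels n Y l i = (if i = 0 then {Lower} else if i = Suc n then {l} else Y `` {i})"

definition flip_above :: "nat \<Rightarrow> (nat \<times> bunk) set \<Rightarrow> (nat \<times> bunk) set" where
  "flip_above c Y = (\<lambda>(i, s). (i, if c < i then flip s else s)) ` Y"

lemma mem_flip_above: "(i, s) \<in> flip_above c Y \<longleftrightarrow> (i, if c < i then flip s else s) \<in> Y"
proof -
  have "(i, s) = (case p of (i, s) \<Rightarrow> (i, if c < i then flip s else s))
      \<longleftrightarrow> p = (i, if c < i then flip s else s)" for p
    by (cases p) (auto split: if_splits)
  then show ?thesis
    by (auto simp only: flip_above_def image_iff bex_simps)
qed

lemma flip_above_flip_above [simp]: "flip_above c (flip_above c Y) = Y"
  by (rule set_eqI) (simp add: split_paired_all mem_flip_above)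

lemma Image_flip_above: "flip_above c Y `` {i} = (if c < i then flip ` (Y `` {i}) else Y `` {i})"
  by (auto simp: mem_flip_above mem_flip_image)

lemma flip_above_subset_sites: "Y \<subseteq> sites n \<Longrightarrow> flip_above c Y \<subseteq> sites n"
  by (auto simp: flip_above_def sites_def)

lemma levels_flip_above:
  "c \<le> n \<Longrightarrow> levels n (flip_above c Y) (flip l) = (\<lambda>i. if c < i then flip ` levels n Y l i else levels n Y l i)"
  by (auto simp: levels_def Image_flip_above fun_eq_iff)

text \<open>These are the positions beyond which a reflection changes no joint. The guard
  \<open>c \<noteq> 0\<close> matters: a set of sites has no element at position \<open>0\<close>,
  whereas the virtual site there has exactly one level, so only a link makes \<open>0\<close> a
  cut.\<close>

definition cut :: "nat \<Rightarrow> (nat \<Rightarrow> bool) \<Rightarrow> (nat \<times> bunk) set \<Rightarrow> nat \<Rightarrow> bool" where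
  "cut n j Y c \<longleftrightarrow> c \<le> n \<and> (j c \<or> c \<noteq> 0 \<and> Y `` {c} \<in> {{}, UNIV})"

lemma cut_flip_above: "cut n j (flip_above c Y) = cut n j Y"
proof -
  have "flip ` A = UNIV \<longleftrightarrow> A = UNIV" for A
    by (simp only: set_eq_iff mem_flip_image all_bunk) auto
  then show ?thesis
    by (auto simp: cut_def Image_flip_above fun_eq_iff)
qed

lemma joined_flip_above:
  assumes "cut n j Y c"
  shows "joined (levels n (flip_above c Y) (flip l)) j = joined (levels n Y l) j"
proof -
  from assms have c: "c \<le> n" by (simp add: cut_def)
  from assms have "j c \<or> levels n Y l c = {} \<or> levels n Y l c = UNIV"
    by (simp add: cut_def levels_def) blast
  then show ?thesis
    unfolding levels_flip_above[OF c] by (rule joined_flip)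
qed

text \<open>A reflection principle: reflecting beyond the first cut exchanges the targets and keeps
  the whole pattern of joints, hence any event \<open>Q\<close>. It is an involution because the set
  of cuts, and with it the least one, stays the same.\<close>

lemma card_cut:
  "card {Y \<in> Pow (sites n). Ex (cut n j Y) \<and> Q (joined (levels n Y Lower) j)} =
   card {Y \<in> Pow (sites n). Ex (cut n j Y) \<and> Q (joined (levels n Y Upper) j)}"
proof -
  define M where "M l = {Y \<in> Pow (sites n). Ex (cut n j Y) \<and> Q (joined (levels n Y l) j)}" for l
  define f where "f Y = flip_above (Least (cut n j Y)) Y" for Y
  have ff: "f (f Y) = Y" for Y
    by (simp add: f_def cut_flip_above)
  have f: "f Y \<in> M (flip l)" if "Y \<in> M l" for Y l
  proof -
    from that have "cut n j Y (Least (cut n j Y))"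
      by (auto simp: M_def intro: LeastI)
    with that show ?thesis
      by (auto simp: M_def f_def cut_flip_above joined_flip_above flip_above_subset_sites)
  qed
  have "bij_betw f (M Lower) (M Upper)"
    by (rule bij_betw_byWitness[where f' = f]) (use ff f[of _ Lower] f[of _ Upper] in auto)
  then show ?thesis
    by (simp add: M_def bij_betw_same_card)
qed

definition single :: "nat \<Rightarrow> (nat \<times> bunk) set set" where
  "single n = {Y \<in> Pow (sites n). \<forall>i\<in>{1..n}. (i, Lower) \<in> Y \<longleftrightarrow> (i, Upper) \<notin> Y}"

lemma finite_single [simp]: "finite (single n)"
  by (rule finite_subset[of _ "Pow (sites n)"]) (auto simp: single_def)

lemma not_cut_iff_single:
  assumes "Y \<subseteq> sites n"
  shows "\<not> Ex (cut n (\<lambda>_. False) Y) \<longleftrightarrow> Y \<in> single n"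
proof -
  have "Y `` {c} \<in> {{}, UNIV} \<longleftrightarrow> \<not> ((c, Lower) \<in> Y \<longleftrightarrow> (c, Upper) \<notin> Y)" for c
    using all_bunk[of "\<lambda>s. (c, s) \<in> Y"] all_bunk[of "\<lambda>s. (c, s) \<notin> Y"] by blast
  with assms show ?thesis
    by (auto simp: cut_def single_def Suc_le_eq)
qed

text \<open>A link at some \<open>c \<le> n\<close> is a cut of every configuration, so everything
  is paired off. Without links the configurations that have a cut still balance, and those in
  \<open>single n\<close> decide.\<close>

lemma card_joined:
  assumes single: "card {Y \<in> single n. Q (joined (levels n Y Lower) (\<lambda>_. False))}
      < card {Y \<in> single n. Q (joined (levels n Y Upper) (\<lambda>_. False))}"
  defines "N \<equiv> \<lambda>j l. card {Y \<in> Pow (sites n). Q (joined (levels n Y l) j)}"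
  shows "c \<le> n \<Longrightarrow> j c \<Longrightarrow> N j Lower = N j Upper"
    and "N (\<lambda>_. False) Lower < N (\<lambda>_. False) Upper"
proof -
  assume "c \<le> n" "j c"
  then have "Ex (cut n j Y)" for Y by (auto simp: cut_def)
  then show "N j Lower = N j Upper"
    using card_cut[of n j Q] by (simp add: N_def)
next
  let ?j = "\<lambda>_. False"
  have "N ?j l = card {Y \<in> Pow (sites n). Ex (cut n ?j Y) \<and> Q (joined (levels n Y l) ?j)}
      + card {Y \<in> single n. Q (joined (levels n Y l) ?j)}" for l
    unfolding N_def
  proof (subst card_Un_disjoint[symmetric])
    show "card {Y \<in> Pow (sites n). Q (joined (levels n Y l) ?j)} =
      card ({Y \<in> Pow (sites n). Ex (cut n ?j Y) \<and> Q (joined (levels n Y l) ?j)}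
        \<union> {Y \<in> single n. Q (joined (levels n Y l) ?j)})"
      using not_cut_iff_single[of _ n] by (intro arg_cong[where f = card]) (auto simp: single_def)
  qed (use not_cut_iff_single[of _ n] in \<open>auto simp: single_def\<close>)
  then show "N ?j Lower < N ?j Upper"
    using single card_cut[of n ?j Q] by simp
qed

section \<open>Amplification\<close>

text \<open>Such a set is determined by its traces on the bundles, and each trace is one of the
  \<open>2 ^ k - 1\<close> proper subsets.\<close>

lemma card_no_full_bundle:
  assumes "\<And>c. c < m \<Longrightarrow> finite (B c) \<and> card (B c) = k"
  shows "card {Z \<in> Pow (\<Union>c<m. B c). \<forall>c<m. \<not> B c \<subseteq> Z} \<le> (2 ^ k - 1) ^ m"
proof -
  let ?f = "\<lambda>Z. \<lambda>c\<in>{..<m}. Z \<inter> B c"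
  let ?P = "PiE {..<m} (\<lambda>c. Pow (B c) - {B c})"
  have "inj_on ?f (Pow (\<Union>c<m. B c))"
  proof (rule inj_onI)
    fix Z Z' assume Z: "Z \<in> Pow (\<Union>c<m. B c)" "Z' \<in> Pow (\<Union>c<m. B c)" and "?f Z = ?f Z'"
    then have "Z \<inter> B c = Z' \<inter> B c" if "c < m" for c
      using that by (metis lessThan_iff restrict_apply')
    with Z show "Z = Z'" by blast
  qed
  then have "inj_on ?f {Z \<in> Pow (\<Union>c<m. B c). \<forall>c<m. \<not> B c \<subseteq> Z}"
    by (rule inj_on_subset) blast
  moreover have "?f Z \<in> ?P" if Z: "\<forall>c<m. \<not> B c \<subseteq> Z" for Z
  proof (rule PiE_I)
    fix c assume c: "c \<in> {..<m}"
    with Z have "Z \<inter> B c \<in> Pow (B c) - {B c}" by blast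
    then show "?f Z c \<in> Pow (B c) - {B c}"
      by (simp only: restrict_apply'[OF c])
  qed (simp only: restrict_apply if_False)
  then have "?f ` {Z \<in> Pow (\<Union>c<m. B c). \<forall>c<m. \<not> B c \<subseteq> Z} \<subseteq> ?P"
    by blast
  moreover have "finite ?P"
    using assms by (intro finite_PiE) auto
  ultimately have "card {Z \<in> Pow (\<Union>c<m. B c). \<forall>c<m. \<not> B c \<subseteq> Z} \<le> card ?P"
    by (rule card_inj_on_le)
  also have "\<dots> = (2 ^ k - 1) ^ m"
    using assms by (simp add: card_PiE card_Pow)
  finally show ?thesis .
qed

lemma ex_bundle_number: "\<exists>m. (C + 1) * (2 ^ k - 1) ^ m < (2 ^ k :: nat) ^ m"
proof -
  define r :: real where "r = (2 ^ k - 1) / 2 ^ k"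
  have "r < 1" by (simp add: r_def)
  then have "\<exists>m. r ^ m < 1 / (real C + 1)"
    by (intro real_arch_pow_inv) auto
  then obtain m where m: "r ^ m < 1 / (real C + 1)" ..
  have "real ((2 ^ k - 1) ^ m) = r ^ m * (2 ^ k) ^ m"
    by (simp add: r_def power_divide of_nat_diff)
  then have "real ((C + 1) * (2 ^ k - 1) ^ m) = (real C + 1) * r ^ m * (2 ^ k) ^ m"
    by (simp only: of_nat_mult of_nat_add of_nat_1 mult.assoc)
  also have "\<dots> < 1 * (2 ^ k) ^ m"
    using m by (intro mult_strict_right_mono) (auto simp: field_simps)
  finally have "real ((C + 1) * (2 ^ k - 1) ^ m) < real ((2 ^ k) ^ m)" by simp
  then show ?thesis by (metis of_nat_less_iff)
qed

text \<open>A state consists of sites (embedded by \<open>h\<close>), possible links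
  \<open>K\<close> and bundles \<open>B c\<close>. Once some bundle is full, the event depends on
  sites and links alone, and there the upper target leads by at least one. Multiplied by the number
  of good bundle states, this lead exceeds the number of all states without a full bundle.\<close>

lemma card_less_of_bundles:
  fixes h :: "nat \<times> bunk \<Rightarrow> 'p"
  assumes inj: "inj_on h (sites n)" and K: "finite K" "h ` sites n \<inter> K = {}"
    and B: "\<And>c. c < m \<Longrightarrow> finite (B c) \<and> card (B c) = k" "disjoint_family_on B {..<m}"
      "\<And>c. c < m \<Longrightarrow> (h ` sites n \<union> K) \<inter> B c = {}"
    and J: "J {} = (\<lambda>_. False)" "\<And>L. L \<subseteq> K \<Longrightarrow> J L = (\<lambda>_. False) \<or> (\<exists>c\<le>n. J L c)"
    and single: "card {Y \<in> single n. Q (joined (levels n Y Lower) (\<lambda>_. False))}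
      < card {Y \<in> single n. Q (joined (levels n Y Upper) (\<lambda>_. False))}"
    and E: "E = h ` sites n \<union> K \<union> (\<Union>c<m. B c)"
    and event: "\<And>X l c. X \<subseteq> E \<Longrightarrow> c < m \<Longrightarrow> B c \<subseteq> X \<Longrightarrow>
      event l X \<longleftrightarrow> Q (joined (levels n {p \<in> sites n. h p \<in> X} l) (J (X \<inter> K)))"
    and m: "(2 ^ (2 * n + card K) + 1) * (2 ^ k - 1) ^ m < (2 ^ k :: nat) ^ m"
  shows "card {X \<in> Pow E. event Lower X} < card {X \<in> Pow E. event Upper X}"
proof -
  let ?A = "Pow (sites n) \<times> Pow K"
  define U where "U = (\<Union>c<m. B c)"
  define bad where "bad = {Z \<in> Pow U. \<forall>c<m. \<not> B c \<subseteq> Z}"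
  define good where "good = {Z \<in> Pow U. \<exists>c<m. B c \<subseteq> Z}"
  define P where "P l = {(Y, L) \<in> ?A. Q (joined (levels n Y l) (J L))}" for l
  define \<phi> where "\<phi> = (\<lambda>((Y, L), Z). h ` Y \<union> L \<union> Z)"
  have U: "finite U" "card U = k * m"
    using B by (auto simp: U_def card_UN_disjoint disjoint_family_on_def)
  have dUL: "h ` sites n \<inter> U = {}" "K \<inter> U = {}"
    using B(3) by (auto simp: U_def)
  have parts: "{p \<in> sites n. h p \<in> \<phi> ((Y, L), Z)} = Y" "\<phi> ((Y, L), Z) \<inter> K = L" "\<phi> ((Y, L), Z) \<inter> U = Z"
    if "Y \<subseteq> sites n" "L \<subseteq> K" "Z \<subseteq> U" for Y L Z
  proof -
    have "p \<in> Y" if "p \<in> sites n" "h p \<in> h ` Y" for p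
      using that inj \<open>Y \<subseteq> sites n\<close> by (meson inj_on_image_mem_iff)
    then show "{p \<in> sites n. h p \<in> \<phi> ((Y, L), Z)} = Y"
      using that K dUL by (fastforce simp: \<phi>_def)
    show "\<phi> ((Y, L), Z) \<inter> K = L" "\<phi> ((Y, L), Z) \<inter> U = Z"
      using that K dUL by (fastforce simp: \<phi>_def)+
  qed
  have inj_\<phi>: "inj_on \<phi> (?A \<times> Pow U)"
  proof (rule inj_on_inverseI)
    fix a assume "a \<in> ?A \<times> Pow U"
    then obtain Y L Z where "a = ((Y, L), Z)" "Y \<subseteq> sites n" "L \<subseteq> K" "Z \<subseteq> U" by auto
    then show "(\<lambda>X. (({p \<in> sites n. h p \<in> X}, X \<inter> K), X \<inter> U)) (\<phi> a) = a"
      using parts by simp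
  qed
  have surj_\<phi>: "\<exists>a\<in>?A \<times> Pow U. X = \<phi> a" if "X \<in> Pow E" for X
    using that by (intro bexI[of _ "(({p \<in> sites n. h p \<in> X}, X \<inter> K), X \<inter> U)"])
      (auto simp: \<phi>_def E U_def)
  have \<phi>_E: "\<phi> a \<in> Pow E" if "a \<in> ?A \<times> Pow U" for a
    using that by (auto simp: \<phi>_def E U_def)
  have event_\<phi>: "event l (\<phi> (a, Z)) \<longleftrightarrow> a \<in> P l" if aZ: "a \<in> ?A" "Z \<in> good" for a Z l
  proof -
    obtain Y L where a: "a = (Y, L)" by (cases a)
    from aZ obtain c where c: "c < m" "B c \<subseteq> Z" and Z: "Z \<subseteq> U" by (auto simp: good_def)
    then have "B c \<subseteq> \<phi> (a, Z)" by (auto simp: \<phi>_def a)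
    moreover have YL: "Y \<subseteq> sites n" "L \<subseteq> K" using aZ by (auto simp: a)
    moreover have "\<phi> (a, Z) \<subseteq> E" using \<phi>_E[of "(a, Z)"] aZ Z by blast
    ultimately show ?thesis
      using event[of "\<phi> (a, Z)" c l] c(1) parts[OF YL Z] by (simp add: a P_def)
  qed
  have fin: "finite (P l)" "finite good" "finite bad" "finite E" for l
  proof -
    show "finite (P l)" by (rule finite_subset[of _ ?A]) (use K in \<open>auto simp: P_def\<close>)
  qed (use U K in \<open>auto simp: good_def bad_def E U_def[symmetric]\<close>)
  have "card (P l) = (\<Sum>L\<in>Pow K. card {Y \<in> Pow (sites n). Q (joined (levels n Y l) (J L))})" for l
  proof -
    have "P l = prod.swap ` (SIGMA L:Pow K. {Y \<in> Pow (sites n). Q (joined (levels n Y l) (J L))})"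
      by (force simp: P_def image_iff)
    then show ?thesis
      using K by (simp add: card_image card_SigmaI)
  qed
  \<comment> \<open>No set of links favours the lower target; strictness comes from
    \<open>L = {}\<close>, where \<open>J L\<close> has no link.\<close>
  moreover have "(\<Sum>L\<in>Pow K. card {Y \<in> Pow (sites n). Q (joined (levels n Y Lower) (J L))})
      < (\<Sum>L\<in>Pow K. card {Y \<in> Pow (sites n). Q (joined (levels n Y Upper) (J L))})"
  proof (rule sum_strict_mono_ex1)
    have "card {Y \<in> Pow (sites n). Q (joined (levels n Y Lower) (J L))}
        \<le> card {Y \<in> Pow (sites n). Q (joined (levels n Y Upper) (J L))}" if "L \<subseteq> K" for L
      using J(2)[OF that]
    proof
      assume "J L = (\<lambda>_. False)"
      then show ?thesis using card_joined(2)[OF single] by simp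
    next
      assume "\<exists>c\<le>n. J L c"
      then show ?thesis using card_joined(1)[OF single] by fastforce
    qed
    then show "\<forall>L\<in>Pow K. card {Y \<in> Pow (sites n). Q (joined (levels n Y Lower) (J L))}
        \<le> card {Y \<in> Pow (sites n). Q (joined (levels n Y Upper) (J L))}" by simp
    show "\<exists>L\<in>Pow K. card {Y \<in> Pow (sites n). Q (joined (levels n Y Lower) (J L))}
        < card {Y \<in> Pow (sites n). Q (joined (levels n Y Upper) (J L))}"
      using card_joined(2)[OF single] J(1) by (intro bexI[of _ "{}"]) auto
  qed (use K in auto)
  ultimately have P: "card (P Lower) + 1 \<le> card (P Upper)" by simp
  have bad: "card bad \<le> (2 ^ k - 1) ^ m"
    unfolding bad_def U_def using B(1) by (rule card_no_full_bundle)
  have "card good + card bad = card (Pow U)"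
    using U by (subst card_Un_disjoint[symmetric])
      (auto simp: good_def bad_def intro!: arg_cong[where f = card])
  then have gb: "card good + card bad = (2 ^ k) ^ m"
    using U by (simp add: card_Pow power_mult)
  have cA: "card ?A = 2 ^ (2 * n + card K)"
    using K by (simp add: card_cartesian_product card_Pow card_sites power_add)
  \<comment> \<open>The summand \<open>+ 1\<close> in the hypothesis on \<open>m\<close> is there to
    absorb the \<open>card bad\<close> on the right of \<open>card good + card bad\<close>.\<close>
  have "card ?A * card bad < card good"
  proof -
    have "(card ?A + 1) * card bad \<le> (card ?A + 1) * (2 ^ k - 1) ^ m"
      by (rule mult_le_mono2[OF bad])
    also have "\<dots> < card good + card bad"
      using m by (simp add: gb cA)
    finally show ?thesis by simp
  qed
  \<comment> \<open>All states without a full bundle are conceded to the lower target.\<close>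
  have "{X \<in> Pow E. event Lower X} \<subseteq> \<phi> ` (P Lower \<times> good \<union> ?A \<times> bad)"
  proof
    fix X assume X: "X \<in> {X \<in> Pow E. event Lower X}"
    then obtain a Z where aZ: "a \<in> ?A" "Z \<in> Pow U" "X = \<phi> (a, Z)"
      using surj_\<phi>[of X] by auto
    with X event_\<phi>[of a Z Lower] have "(a, Z) \<in> P Lower \<times> good \<union> ?A \<times> bad"
      by (auto simp: good_def bad_def)
    with aZ show "X \<in> \<phi> ` (P Lower \<times> good \<union> ?A \<times> bad)" by blast
  qed
  then have "card {X \<in> Pow E. event Lower X} \<le> card (P Lower \<times> good \<union> ?A \<times> bad)"
    using fin K by (intro surj_card_le) auto
  also have "\<dots> \<le> card (P Lower) * card good + card ?A * card bad"
    using card_Un_le[of "P Lower \<times> good" "?A \<times> bad"] by (simp add: card_cartesian_product)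
  also have "\<dots> < card (P Lower) * card good + card good"
    using \<open>card ?A * card bad < card good\<close> by simp
  also have "\<dots> \<le> card (P Upper) * card good"
    using mult_le_mono1[OF P, of "card good"] by simp
  also have "\<dots> = card (\<phi> ` (P Upper \<times> good))"
    using inj_on_subset[OF inj_\<phi>, of "P Upper \<times> good"]
    by (subst card_image) (auto simp: P_def good_def card_cartesian_product)
  also have "\<dots> \<le> card {X \<in> Pow E. event Upper X}"
  proof (rule card_mono)
    show "\<phi> ` (P Upper \<times> good) \<subseteq> {X \<in> Pow E. event Upper X}"
    proof clarify
      fix a b Z assume aZ: "(a, b) \<in> P Upper" "Z \<in> good"
      moreover have "(a, b) \<in> ?A" "Z \<in> Pow U" using aZ by (auto simp: P_def good_def)
      ultimately show "\<phi> ((a, b), Z) \<in> Pow E \<and> event Upper (\<phi> ((a, b), Z))"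
        using event_\<phi>[of "(a, b)" Z Upper] \<phi>_E[of "((a, b), Z)"] by simp
    qed
  qed (use fin in auto)
  finally show ?thesis .
qed

text \<open>Serves \<open>E2\<close>, \<open>E4\<close> and \<open>E6\<close>, whose prescriptions
  leave exactly the choice of one level per site: \<open>B\<close> collects what is always retained,
  and the sample space is a copy of \<open>single n\<close>.\<close>

lemma card_less_of_single:
  assumes inj: "inj_on h (sites n)" and B: "h ` sites n \<inter> B = {}"
    and single: "card {Y \<in> single n. Q (joined (levels n Y Lower) (\<lambda>_. False))}
      < card {Y \<in> single n. Q (joined (levels n Y Upper) (\<lambda>_. False))}"
    and \<Omega>: "\<Omega> = (\<lambda>Y. h ` Y \<union> B) ` single n"
    and event: "\<And>Y l. Y \<in> single n \<Longrightarrow>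
      event l (h ` Y \<union> B) \<longleftrightarrow> Q (joined (levels n Y l) (\<lambda>_. False))"
  shows "card {X \<in> \<Omega>. event Lower X} < card {X \<in> \<Omega>. event Upper X}"
proof -
  have inj': "inj_on (\<lambda>Y. h ` Y \<union> B) (single n)"
  proof (rule inj_onI)
    fix Y Y' assume Y: "Y \<in> single n" "Y' \<in> single n" and eq: "h ` Y \<union> B = h ` Y' \<union> B"
    then have sub: "Y \<subseteq> sites n" "Y' \<subseteq> sites n" by (auto simp: single_def)
    then have "h ` Y \<inter> B = {}" "h ` Y' \<inter> B = {}" using B by blast+
    with eq have "h ` Y = h ` Y'" by blast
    with inj sub show "Y = Y'" by (simp add: inj_on_image_eq_iff)
  qed
  have "card {X \<in> \<Omega>. event l X} = card {Y \<in> single n. Q (joined (levels n Y l) (\<lambda>_. False))}" for l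
  proof -
    have "{X \<in> \<Omega>. event l X} =
        (\<lambda>Y. h ` Y \<union> B) ` {Y \<in> single n. Q (joined (levels n Y l) (\<lambda>_. False))}"
      by (auto simp: \<Omega> event)
    then show ?thesis
      by (simp add: card_image inj_on_subset[OF inj'])
  qed
  with single show ?thesis by simp
qed

section \<open>Exact counts by listing words of levels\<close>

lemma mem_set_enumerate_Suc: "(i, s) \<in> set (List.enumerate (Suc 0) xs) \<longleftrightarrow> i \<in> {1..length xs} \<and> s = xs ! (i - 1)"
  by (auto simp: in_set_enumerate_eq)

text \<open>Identifies a configuration with the word of its levels. The enumeration starts at 1
  because the sites do; position 0 belongs to the virtual site.\<close>

lemma bij_betw_enumerate_single:
  "bij_betw (\<lambda>xs. set (List.enumerate 1 xs)) {xs. length xs = n} (single n)"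
proof (rule bij_betw_byWitness[where f' = "\<lambda>Y. map (\<lambda>i. if (Suc i, Lower) \<in> Y then Lower else Upper) [0..<n]"])
  show "\<forall>xs\<in>{xs. length xs = n}.
      map (\<lambda>i. if (Suc i, Lower) \<in> set (List.enumerate 1 xs) then Lower else Upper) [0..<n] = xs"
    by (auto simp: mem_set_enumerate_Suc intro!: nth_equalityI) (metis bunk.exhaust)
  show "\<forall>Y\<in>single n.
      set (List.enumerate 1 (map (\<lambda>i. if (Suc i, Lower) \<in> Y then Lower else Upper) [0..<n])) = Y"
  proof (intro ballI set_eqI)
    fix Y and p :: "nat \<times> bunk" assume Y: "Y \<in> single n"
    obtain i s where p: "p = (i, s)" by (cases p)
    show "p \<in> set (List.enumerate 1 (map (\<lambda>i. if (Suc i, Lower) \<in> Y then Lower else Upper) [0..<n]))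
        \<longleftrightarrow> p \<in> Y"
    proof (cases "i \<in> {1..n}")
      case True
      then have "(i, Lower) \<in> Y \<longleftrightarrow> (i, Upper) \<notin> Y" using Y by (simp add: single_def)
      moreover obtain k where "i = Suc k" "k < n" using True by (cases i) auto
      ultimately show ?thesis by (cases s) (simp_all add: p mem_set_enumerate_Suc)
    next
      case False
      then have "p \<notin> Y" using Y by (auto simp: p single_def sites_def)
      with False show ?thesis by (auto simp: p mem_set_enumerate_Suc)
    qed
  qed
  show "(\<lambda>xs. set (List.enumerate 1 xs)) ` {xs. length xs = n} \<subseteq> single n"
  proof clarify
    fix xs :: "bunk list"
    have "Lower = xs ! (i - 1) \<longleftrightarrow> Upper \<noteq> xs ! (i - 1)" for i
      by (cases "xs ! (i - 1)") auto
    then show "set (List.enumerate 1 xs) \<in> single (length xs)"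
      by (auto simp: single_def sites_def mem_set_enumerate_Suc)
  qed
qed auto

text \<open>Turns the count into a concrete list computation that simplification can finish. The
  word is padded with the levels of the two virtual sites. The hypothesis on \<open>Q\<close>
  confines it to the joints \<open>0\<close> to \<open>n\<close>, the only ones for which both list
  positions exist.\<close>

lemma card_single:
  assumes "\<And>a b. (\<And>i. i \<le> n \<Longrightarrow> a i = b i) \<Longrightarrow> Q a = Q b"
  shows "card {Y \<in> single n. Q (joined (levels n Y l) (\<lambda>_. False))} =
    length (filter (\<lambda>xs. Q (\<lambda>i. (Lower # xs @ [l]) ! i = (Lower # xs @ [l]) ! Suc i))
      (List.n_lists n [Lower, Upper]))"
proof -
  let ?P = "\<lambda>xs. Q (\<lambda>i. (Lower # xs @ [l]) ! i = (Lower # xs @ [l]) ! Suc i)"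
  let ?f = "\<lambda>xs. set (List.enumerate 1 xs)"
  have event: "Q (joined (levels n (?f xs) l) (\<lambda>_. False)) \<longleftrightarrow> ?P xs" if n: "length xs = n" for xs
  proof (rule assms)
    have "levels n (?f xs) l i = {(Lower # xs @ [l]) ! i}" if "i \<le> Suc n" for i
      using that n by (auto simp: levels_def mem_set_enumerate_Suc nth_Cons' nth_append)
    then show "joined (levels n (?f xs) l) (\<lambda>_. False) i
        \<longleftrightarrow> (Lower # xs @ [l]) ! i = (Lower # xs @ [l]) ! Suc i" if "i \<le> n" for i
      using that by (auto simp: joined_def)
  qed
  have "{Y \<in> single n. Q (joined (levels n Y l) (\<lambda>_. False))} = ?f ` {xs. length xs = n \<and> ?P xs}"
    unfolding bij_betw_imp_surj_on[OF bij_betw_enumerate_single, symmetric]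
    by (simp only: Compr_image_eq mem_Collect_eq event cong: conj_cong)
  also have "card \<dots> = card {xs. length xs = n \<and> ?P xs}"
    by (intro card_image inj_on_subset[OF bij_betw_imp_inj_on[OF bij_betw_enumerate_single[of n]]]) auto
  also have "{xs. length xs = n \<and> ?P xs} = set (filter ?P (List.n_lists n [Lower, Upper]))"
    by (auto simp: set_n_lists UNIV_bunk[symmetric])
  also have "card \<dots> = length (filter ?P (List.n_lists n [Lower, Upper]))"
    by (intro distinct_card distinct_filter distinct_n_lists) simp
  finally show ?thesis .
qed

text \<open>For sites on a path in which sites 1 and 3, sites 2 and 5, and sites 4 and 6 are also tied
  together, this expresses in terms of the joints that the two ends are connected.\<close>

definition tied6 :: "(nat \<Rightarrow> bool) \<Rightarrow> bool" where
  "tied6 a \<longleftrightarrow> a 0 \<and> a 6 \<and> (a 3 \<or> (a 1 \<or> a 2) \<and> (a 4 \<or> a 5))"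

text \<open>The same condition when the two ends themselves take the places of sites 1 and 6.\<close>

definition tied4 :: "(nat \<Rightarrow> bool) \<Rightarrow> bool" where
  "tied4 a \<longleftrightarrow> a 2 \<or> (a 0 \<or> a 1) \<and> (a 3 \<or> a 4)"

text \<open>Intact joints \<open>0\<close> and \<open>6\<close> fix the levels of sites 1 and 6, so
  the relevant words are the 16 words for sites 2 to 5, with the same condition on the five inner
  joints as in \<open>tied4\<close>.\<close>

lemma card_single_tied6:
  "card {Y \<in> single 6. tied6 (joined (levels 6 Y Lower) (\<lambda>_. False))}
    < card {Y \<in> single 6. tied6 (joined (levels 6 Y Upper) (\<lambda>_. False))}"
proof -
  have "tied6 a = tied6 b" if "\<And>i. i \<le> 6 \<Longrightarrow> a i = b i" for a b
    using that by (simp add: tied6_def)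
  note * = card_single[of 6 tied6, OF this]
  show ?thesis
    by (subst (1 2) *) (auto simp: tied6_def numeral_eq_Suc)
qed

lemma card_single_tied4:
  "card {Y \<in> single 4. tied4 (joined (levels 4 Y Lower) (\<lambda>_. False))}
    < card {Y \<in> single 4. tied4 (joined (levels 4 Y Upper) (\<lambda>_. False))}"
proof -
  have "tied4 a = tied4 b" if "\<And>i. i \<le> 4 \<Longrightarrow> a i = b i" for a b
    using that by (simp add: tied4_def)
  note * = card_single[of 4 tied4, OF this]
  show ?thesis
    by (subst (1 2) *) (auto simp: tied4_def numeral_eq_Suc)
qed

text \<open>The map \<open>f\<close> lets the site models be counted over sets of open vertices,
  which are uniform, although the events speak about retained edges.\<close>

lemma prob_less:
  assumes "finite \<Omega>" "card {X \<in> \<Omega>. P (f X)} < card {X \<in> \<Omega>. Q (f X)}"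
  shows "\<P>(X in map_pmf f (pmf_of_set \<Omega>). P X) < \<P>(X in map_pmf f (pmf_of_set \<Omega>). Q X)"
proof -
  from assms have ne: "\<Omega> \<noteq> {}" by auto
  with assms(1) have "\<P>(X in measure_pmf (map_pmf f (pmf_of_set \<Omega>)). R X) = card {X \<in> \<Omega>. R (f X)} / card \<Omega>" for R
    by (simp add: measure_pmf_of_set vimage_def Int_def)
  with assms ne show ?thesis
    by (simp add: divide_strict_right_mono card_gt_0_iff)
qed

lemmas prob_less_id = prob_less[where f = id, unfolded map_pmf_id id_apply]

section \<open>Counterexamples\<close>

text \<open>Along the sites 1 to 6 the groups read 0 1 0 2 1 2: an Eulerian trail of the triangle
  with sides 01 and 12 doubled.\<close>

definition group :: "nat \<Rightarrow> nat" where
  "group i = (if i \<in> {1, 3} then 0 else if i \<in> {2, 5} then 1 else 2)"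

lemma group_simps [simp]:
  "group (Suc 0) = 0" "group 2 = 1" "group 3 = 0" "group 4 = 2" "group 5 = 1" "group 6 = 2"
  by (simp_all add: group_def)

lemma group_less_3 [simp]: "group i < 3"
  by (simp add: group_def)

text \<open>Numbers below 7 are reserved for the vertices of the chain. The group of a hub can be
  recovered as a residue modulo 3, whatever the copy \<open>c\<close>.\<close>

definition hub :: "nat \<Rightarrow> nat \<Rightarrow> nat" where
  "hub c g = 7 + 3 * c + g"

lemma hub_inject: "g < 3 \<Longrightarrow> g' < 3 \<Longrightarrow> hub c g = hub c' g' \<longleftrightarrow> c = c' \<and> g = g'"
  unfolding hub_def by presburger

lemma hub_ge_7 [simp]: "7 \<le> hub c g"
  by (simp add: hub_def)

definition hubs :: "nat \<Rightarrow> nat set" where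
  "hubs m = {hub c g | c g. c < m \<and> g < 3}"

lemma hubs_eq_UN: "hubs m = (\<Union>c<m. hub c ` {..<3})"
  by (auto simp: hubs_def)

lemma finite_hubs [simp]: "finite (hubs m)"
  by (simp add: hubs_eq_UN)

lemma hubs_ge_7: "v \<in> hubs m \<Longrightarrow> 7 \<le> v"
  by (auto simp: hubs_def)

lemma hubs_1: "hubs (Suc 0) = hub 0 ` {..<3}"
  by (simp add: hubs_eq_UN lessThan_Suc)

text \<open>One label for a site and for all copies of its hub, so that a single invariant controls
  complete and incomplete copies alike.\<close>

definition colour :: "nat \<Rightarrow> nat" where
  "colour v = (if v < 7 then group v else (v - 7) mod 3)"

lemma colour_hub [simp]: "g < 3 \<Longrightarrow> colour (hub c g) = g"
  by (simp add: colour_def hub_def)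

lemma colour_site [simp]: "v \<in> {1..6} \<Longrightarrow> colour v = group v"
  by (simp add: colour_def)

text \<open>\<open>reached a g\<close>: given the joints \<open>a\<close>, the lower end of the chain is connected to the hubs of group \<open>g\<close>.\<close>

definition reached :: "(nat \<Rightarrow> bool) \<Rightarrow> nat \<Rightarrow> bool" where
  "reached a g \<longleftrightarrow> a 0 \<and>
     (if g = 0 then True
      else if g = 1 then a 1 \<or> a 2 \<or> a 3 \<and> (a 4 \<or> a 5)
      else a 3 \<or> (a 1 \<or> a 2) \<and> (a 4 \<or> a 5))"

lemma cases_1_to_5:
  assumes "i \<in> {1..5}"
  obtains "i = 1" | "i = 2" | "i = 3" | "i = 4" | "i = (5 :: nat)"
  using assms by force

text \<open>An intact joint is a side of the triangle that can be crossed, so its two groups are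
  reached together. Checked joint by joint.\<close>

lemma reached_Suc:
  assumes "i \<in> {1..5}" "a i"
  shows "reached a (group (Suc i)) = reached a (group i)"
  using assms(1)
  by (rule cases_1_to_5) (use assms(2) in \<open>auto simp: reached_def group_def\<close>)

lemma tied6_iff_reached: "tied6 a \<longleftrightarrow> a 6 \<and> reached a 2"
  by (auto simp: tied6_def reached_def)

text \<open>Here \<open>H g\<close> stands for the hub of group \<open>g\<close> in a complete copy.
  Symmetry is used because the trail crosses joint 2 from group 1 to group 0 and joint 4 from group
  2 to group 1, against the direction in which they are wanted.\<close>

lemma tied6_imp_rtranclp:
  assumes "tied6 a" and sym: "symp R"
    and start: "a 0 \<Longrightarrow> R\<^sup>*\<^sup>* u (H 0)" and stop: "a 6 \<Longrightarrow> R\<^sup>*\<^sup>* (H 2) v"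
    and step: "\<And>i. i \<in> {1..5} \<Longrightarrow> a i \<Longrightarrow> R\<^sup>*\<^sup>* (H (group i)) (H (group (Suc i)))"
  shows "R\<^sup>*\<^sup>* u v"
proof -
  have sym': "R\<^sup>*\<^sup>* x y \<Longrightarrow> R\<^sup>*\<^sup>* y x" for x y
    using symp_rtranclp[OF sym] by (rule sympD)
  have "a 1 \<or> a 2 \<Longrightarrow> R\<^sup>*\<^sup>* (H 0) (H 1)" "a 3 \<Longrightarrow> R\<^sup>*\<^sup>* (H 0) (H 2)" "a 4 \<or> a 5 \<Longrightarrow> R\<^sup>*\<^sup>* (H 1) (H 2)"
    using step[of 1] step[of 2] step[of 3] step[of 4] step[of 5] by (auto simp: numeral_2_eq_2[symmetric] intro: sym')
  with assms(1) have "R\<^sup>*\<^sup>* (H 0) (H 2)"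
    unfolding tied6_def by (meson rtranclp_trans)
  with assms(1) start stop show ?thesis
    unfolding tied6_def by (meson rtranclp_trans)
qed

section \<open>Connectivity in the retained edges\<close>

definition shares_edge :: "'p set set \<Rightarrow> 'p \<Rightarrow> 'p \<Rightarrow> bool" where
  "shares_edge X x y \<longleftrightarrow> (\<exists>e\<in>X. x \<in> e \<and> y \<in> e)"

lemma connects_iff: "connects X = (shares_edge X)\<^sup>*\<^sup>*"
  by (intro ext) (simp add: connects_def path_between_iff_rtranclp shares_edge_def[abs_def])

lemma symp_shares_edge: "symp (shares_edge X)"
  by (auto simp: symp_def shares_edge_def)

lemma shares_edgeI: "e \<in> X \<Longrightarrow> x \<in> e \<Longrightarrow> y \<in> e \<Longrightarrow> shares_edge X x y"
  by (auto simp: shares_edge_def)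

lemma shares_edge_vertical: "vertical v \<in> X \<Longrightarrow> shares_edge X (v, s) (v, t)"
  by (rule shares_edgeI) (cases s; cases t; simp add: vertical_def)+

lemma mem_horizontal [simp]: "(v, s) \<in> horizontal t e \<longleftrightarrow> v \<in> e \<and> s = t"
  by (auto simp: horizontal_def)

lemma mem_vertical [simp]: "(v, s) \<in> vertical w \<longleftrightarrow> v = w"
  by (cases s) (auto simp: vertical_def)

lemma bunkbed_verts_eq: "bunkbed_verts V = V \<times> UNIV"
  by (simp add: bunkbed_verts_def UNIV_bunk)

lemma horizontal_mem_bunkbed_edges: "e \<in> E \<Longrightarrow> horizontal s e \<in> bunkbed_edges V E"
  by (cases s) (auto simp: bunkbed_edges_def)

lemma bunkbed_edgesE:
  assumes "e \<in> bunkbed_edges V E"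
  obtains s e' where "e' \<in> E" "e = horizontal s e'" | v where "v \<in> V" "e = vertical v"
  using assms by (auto simp: bunkbed_edges_def)

subsection \<open>Site percolation\<close>

definition path_verts :: "nat \<Rightarrow> nat set" where
  "path_verts m = {1..6} \<union> hubs m"

definition path_edges :: "nat \<Rightarrow> nat set set" where
  "path_edges m = {{i, Suc i} | i. i \<in> {1..5}} \<union> {{i, hub c (group i)} | i c. i \<in> {1..6} \<and> c < m}"

lemma finite_simple_graph_path: "finite_simple_graph (path_verts m) (path_edges m)"
proof -
  have "hub c (group i) \<in> hubs m" if "c < m" for c i
    using that group_less_3 unfolding hubs_def by blast
  moreover have "i \<noteq> hub c (group i)" if "i \<le> 6" for i c
    using that hub_ge_7[of c "group i"] by linarith
  ultimately show ?thesis
    by (auto simp: finite_simple_graph_def path_verts_def path_edges_def)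
qed

text \<open>An edge to a hub stays within one colour, and an edge of the path changes colour only
  across an intact joint.\<close>

lemma path_edge_reached:
  assumes e: "e \<in> path_edges m" "v \<in> e" "w \<in> e"
    and joint: "\<And>i. i \<in> {1..5} \<Longrightarrow> e = {i, Suc i} \<Longrightarrow> a i"
    and v: "reached a (colour v)"
  shows "reached a (colour w)"
proof -
  from e(1) consider i where "i \<in> {1..5}" "e = {i, Suc i}"
    | i c where "i \<in> {1..6}" "e = {i, hub c (group i)}"
    by (auto simp: path_edges_def)
  then show ?thesis
  proof cases
    case 1
    then have "reached a (colour (Suc i)) = reached a (colour i)"
      using reached_Suc[OF _ joint] by simp
    with 1 e v show ?thesis by auto
  next
    case 2
    then have "colour v = group i" "colour w = group i" using e by auto
    with v show ?thesis by simp
  qed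
qed

text \<open>The complete copy \<open>c\<close> supplies all ties. Conversely, every retained edge,
  vertical ones included, preserves \<open>reached a\<close> of the colour, so the other copies,
  open in whatever way, create no further connection.\<close>

lemma connects_path_iff:
  assumes U: "U \<subseteq> bunkbed_verts (path_verts m)" and c: "c < m" "hub c ` {..<3} \<times> UNIV \<subseteq> U"
  shows "connects (retained_edges (bunkbed_edges (path_verts m) (path_edges m)) U) (1, Lower) (6, l)
    \<longleftrightarrow> tied6 (joined (levels 6 {p \<in> sites 6. p \<in> U} l) (\<lambda>_. False))"
proof -
  define a where "a = joined (levels 6 {p \<in> sites 6. p \<in> U} l) (\<lambda>_. False)"
  define X where "X = retained_edges (bunkbed_edges (path_verts m) (path_edges m)) U"
  let ?R = "shares_edge X"
  have lev: "levels 6 {p \<in> sites 6. p \<in> U} l i = {s. (i, s) \<in> U}" if "i \<in> {1..6}" for i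
    using that by (auto simp: levels_def sites_def)
  have a: "a i \<longleftrightarrow> (\<exists>s. (i, s) \<in> U \<and> (Suc i, s) \<in> U)" if "i \<in> {1..5}" for i
    using that lev[of i] lev[of "Suc i"] by (auto simp: a_def joined_def)
  have a0: "a 0 \<longleftrightarrow> (1, Lower) \<in> U" and a6: "a 6 \<longleftrightarrow> (6, l) \<in> U"
    using lev[of 1] lev[of 6] by (auto simp: a_def joined_def levels_def[of _ _ _ 0] levels_def[of _ _ _ 7])
  have hor: "horizontal s e \<in> X" if "e \<in> path_edges m" "\<And>v. v \<in> e \<Longrightarrow> (v, s) \<in> U" for s e
  proof -
    have "horizontal s e \<subseteq> U" using that(2) by (auto simp: horizontal_def)
    with that(1) show ?thesis by (simp add: X_def retained_edges_def horizontal_mem_bunkbed_edges)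
  qed
  have hubU: "(hub c g, s) \<in> U" if "g < 3" for g s
    using c(2) that by auto
  have hubR: "?R (hub c g, s) (hub c g, t)" if "g < 3" for g s t
  proof (rule shares_edge_vertical)
    have "hub c g \<in> path_verts m"
      using c(1) that unfolding path_verts_def hubs_def by blast
    moreover have "vertical (hub c g) \<subseteq> U"
      using hubU[OF that] by (auto simp: vertical_def)
    ultimately show "vertical (hub c g) \<in> X"
      by (auto simp: X_def retained_edges_def bunkbed_edges_def)
  qed
  have siteR: "?R\<^sup>*\<^sup>* (i, s) (hub c (group i), Lower)" if "i \<in> {1..6}" "(i, s) \<in> U" for i s
  proof -
    have "{i, hub c (group i)} \<in> path_edges m"
      using that(1) c(1) unfolding path_edges_def by blast
    then have "horizontal s {i, hub c (group i)} \<in> X"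
      using that(2) hubU by (intro hor) auto
    then have "?R (i, s) (hub c (group i), s)" by (rule shares_edgeI) auto
    with hubR[of "group i" s Lower] show ?thesis by simp
  qed
  have siteR': "?R\<^sup>*\<^sup>* (hub c (group i), Lower) (i, s)" if "i \<in> {1..6}" "(i, s) \<in> U" for i s
    using symp_rtranclp[OF symp_shares_edge] siteR[OF that] by (rule sympD)
  have "?R\<^sup>*\<^sup>* (1, Lower) (6, l)" if "tied6 a"
    using that symp_shares_edge
  proof (rule tied6_imp_rtranclp[where H = "\<lambda>g. (hub c g, Lower)"])
    show "?R\<^sup>*\<^sup>* (1, Lower) (hub c 0, Lower)" if "a 0"
      using siteR[of 1 Lower] that a0 by simp
    show "?R\<^sup>*\<^sup>* (hub c 2, Lower) (6, l)" if "a 6"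
      using siteR'[of 6 l] that a6 by simp
    show "?R\<^sup>*\<^sup>* (hub c (group i), Lower) (hub c (group (Suc i)), Lower)" if i: "i \<in> {1..5}" "a i" for i
    proof -
      obtain s where s: "(i, s) \<in> U" "(Suc i, s) \<in> U" using a i by blast
      have "{i, Suc i} \<in> path_edges m" using i(1) unfolding path_edges_def by blast
      then have "horizontal s {i, Suc i} \<in> X" using s by (intro hor) auto
      then have "?R (i, s) (Suc i, s)" by (rule shares_edgeI) auto
      then show ?thesis
        using siteR'[of i s] siteR[of "Suc i" s] s i(1)
        by (auto intro: rtranclp_trans)
    qed
  qed
  moreover have "tied6 a" if R: "?R\<^sup>*\<^sup>* (1, Lower) (6, l)"
  proof -
    have sub: "e \<subseteq> U" if "e \<in> X" for e
      using that by (auto simp: X_def retained_edges_def)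
    \<comment> \<open>The two ends differ, so the path has a first edge; its retention forces the
      start vertex to be open, which is joint \<open>0\<close>.\<close>
    from R obtain z where "?R (1, Lower) z"
      by (auto elim: converse_rtranclpE)
    then have a0': "a 0" using sub a0 by (auto simp: shares_edge_def)
    have "fst x \<in> path_verts m \<and> (x = (1, Lower) \<or> x \<in> U) \<and> reached a (colour (fst x))" if "?R\<^sup>*\<^sup>* (1, Lower) x" for x
      using that
    proof (induction rule: rtranclp_induct)
      case base
      from a0' show ?case by (simp add: reached_def path_verts_def)
    next
      case (step x y)
      then obtain e where e: "e \<in> X" "x \<in> e" "y \<in> e" by (auto simp: shares_edge_def)
      obtain v s w t where xy: "x = (v, s)" "y = (w, t)" by (cases x, cases y)
      have yU: "y \<in> U" using e sub by blast
      from e(1) have "e \<in> bunkbed_edges (path_verts m) (path_edges m)"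
        by (simp add: X_def retained_edges_def)
      then have "reached a (colour w)"
      proof (cases rule: bunkbed_edgesE)
        case (1 r e')
        have "a i" if "i \<in> {1..5}" "e' = {i, Suc i}" for i
        proof -
          have "(i, r) \<in> e" "(Suc i, r) \<in> e" using 1(2) that by auto
          then show ?thesis using a[OF that(1)] sub[OF e(1)] by blast
        qed
        then show ?thesis
          using path_edge_reached[OF 1(1), of v w a] e 1(2) step.IH xy by simp
      next
        case (2 x)
        with e step.IH show ?thesis by (simp add: xy)
      qed
      with yU U show ?case by (auto simp: xy bunkbed_verts_eq)
    qed
    from this[OF R] have "(6, l) \<in> U" "reached a (colour 6)" by auto
    then show ?thesis by (simp add: tied6_iff_reached a6)
  qed
  ultimately show ?thesis
    unfolding connects_iff X_def[symmetric] a_def[symmetric] by blast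
qed

lemma E1_counterexample:
  "\<exists>(V :: nat set) E. finite_simple_graph V E \<and> (\<exists>u\<in>V. \<exists>v\<in>V.
     \<P>(X in E1 V E. connects X (u, Lower) (v, Lower))
       < \<P>(X in E1 V E. connects X (u, Lower) (v, Upper)))"
proof -
  \<comment> \<open>There are 6 sites on two levels, and a bundle consists of three hubs on two
    levels.\<close>
  obtain m :: nat where m: "(2 ^ 12 + 1) * (2 ^ 6 - 1) ^ m < (2 ^ 6 :: nat) ^ m"
    using ex_bundle_number[of "2 ^ 12" 6] by blast
  let ?V = "path_verts m" and ?E = "path_edges m"
  let ?ev = "\<lambda>l U. connects (retained_edges (bunkbed_edges ?V ?E) U) (1, Lower) (6, l)"
  have "card {U \<in> Pow (bunkbed_verts ?V). ?ev Lower U} < card {U \<in> Pow (bunkbed_verts ?V). ?ev Upper U}"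
  \<comment> \<open>A vertical edge at a site is retained exactly when the site is open on both
    levels, so it is no independent link: \<open>K\<close> is empty and \<open>J\<close> constantly
    false.\<close>
  proof (rule card_less_of_bundles[where h = id and K = "{}" and n = 6 and k = 6 and m = m
        and B = "\<lambda>c. hub c ` {..<3} \<times> UNIV" and J = "\<lambda>_ _. False" and Q = tied6])
    show "finite (hub c ` {..<3} \<times> (UNIV :: bunk set)) \<and> card (hub c ` {..<3} \<times> (UNIV :: bunk set)) = 6" for c
    proof -
      have "inj_on (hub c) {..<3}" by (auto simp: inj_on_def hub_def)
      then show ?thesis by (simp add: card_cartesian_product card_image UNIV_bunk)
    qed
    show "disjoint_family_on (\<lambda>c. hub c ` {..<3} \<times> (UNIV :: bunk set)) {..<m}"
      by (auto simp: disjoint_family_on_def hub_inject)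
    show "(id ` sites 6 \<union> {}) \<inter> hub c ` {..<3} \<times> UNIV = {}" for c
      by (auto simp: sites_def hub_def)
    show "bunkbed_verts ?V = id ` sites 6 \<union> {} \<union> (\<Union>c<m. hub c ` {..<3} \<times> UNIV)"
      by (auto simp: bunkbed_verts_eq path_verts_def sites_def hubs_eq_UN)
    show "(2 ^ (2 * 6 + card {}) + 1) * (2 ^ 6 - 1) ^ m < (2 ^ 6 :: nat) ^ m"
      using m by simp
  qed (use connects_path_iff card_single_tied6 in auto)
  then have "\<P>(X in E1 ?V ?E. connects X (1, Lower) (6, Lower))
      < \<P>(X in E1 ?V ?E. connects X (1, Lower) (6, Upper))"
    unfolding E1_def by (intro prob_less) (simp_all add: bunkbed_verts_eq path_verts_def)
  moreover have "1 \<in> ?V" "6 \<in> ?V" by (auto simp: path_verts_def)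
  ultimately show ?thesis using finite_simple_graph_path by blast
qed

text \<open>One copy of the hubs is enough, since choosing the hubs as \<open>T\<close> opens them
  on both levels and leaves one level for each path vertex.\<close>

lemma E2_counterexample:
  "\<exists>(V :: nat set) E T. finite_simple_graph V E \<and> T \<subseteq> V \<and> (\<exists>u\<in>V. \<exists>v\<in>V.
     \<P>(X in E2 V E T. connects X (u, Lower) (v, Lower))
       < \<P>(X in E2 V E T. connects X (u, Lower) (v, Upper)))"
proof -
  let ?V = "path_verts (Suc 0)" and ?E = "path_edges (Suc 0)" and ?T = "hubs (Suc 0)"
  let ?ev = "\<lambda>l U. connects (retained_edges (bunkbed_edges ?V ?E) U) (1, Lower) (6, l)"
  define \<Omega> where "\<Omega> = {U. U \<subseteq> bunkbed_verts ?V \<and>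
        (\<forall>v\<in>?T. (v, Lower) \<in> U \<and> (v, Upper) \<in> U) \<and>
        (\<forall>v\<in>?V - ?T. (v, Lower) \<in> U \<longleftrightarrow> (v, Upper) \<notin> U)}"
  have VT: "?V - ?T = {1..6}" "?V = {1..6} \<union> ?T" "{1..6} \<inter> ?T = {}"
    by (auto simp: path_verts_def dest: hubs_ge_7)
  have \<Omega>: "\<Omega> = (\<lambda>Y. id ` Y \<union> ?T \<times> UNIV) ` single 6"
  proof (intro equalityI subsetI)
    fix U assume U: "U \<in> \<Omega>"
    then have "?T \<times> UNIV \<subseteq> U"
      by (auto simp: \<Omega>_def UNIV_bunk)
    moreover from U have "U \<inter> sites 6 \<in> single 6"
      by (auto simp: \<Omega>_def single_def sites_def VT(1))
    moreover from U have "U \<subseteq> sites 6 \<union> ?T \<times> UNIV"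
      by (auto simp: \<Omega>_def bunkbed_verts_eq sites_def VT(2))
    ultimately show "U \<in> (\<lambda>Y. id ` Y \<union> ?T \<times> UNIV) ` single 6"
      by (intro image_eqI[of _ _ "U \<inter> sites 6"]) auto
  next
    fix U assume "U \<in> (\<lambda>Y. id ` Y \<union> ?T \<times> UNIV) ` single 6"
    then show "U \<in> \<Omega>"
      using VT by (auto simp: \<Omega>_def single_def sites_def bunkbed_verts_eq)
  qed
  have "card {U \<in> \<Omega>. ?ev Lower U} < card {U \<in> \<Omega>. ?ev Upper U}"
  proof (rule card_less_of_single[OF _ _ card_single_tied6 \<Omega>])
    show "id ` sites 6 \<inter> ?T \<times> UNIV = {}"
      using VT(3) by (auto simp: sites_def)
    show "?ev l (id ` Y \<union> ?T \<times> UNIV) \<longleftrightarrow> tied6 (joined (levels 6 Y l) (\<lambda>_. False))"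
      if "Y \<in> single 6" for Y l
    proof -
      have Y: "Y \<subseteq> sites 6" using that by (simp add: single_def)
      have "{p \<in> sites 6. p \<in> id ` Y \<union> ?T \<times> UNIV} = Y"
        using Y VT(3) by (auto simp: sites_def)
      moreover have "id ` Y \<union> ?T \<times> UNIV \<subseteq> bunkbed_verts ?V"
        using Y by (auto simp: sites_def bunkbed_verts_eq VT(2))
      ultimately show ?thesis
        using connects_path_iff[of "id ` Y \<union> ?T \<times> UNIV" "Suc 0" 0 l] by (auto simp: hubs_1)
    qed
  qed simp
  then have "\<P>(X in E2 ?V ?E ?T. connects X (1, Lower) (6, Lower))
      < \<P>(X in E2 ?V ?E ?T. connects X (1, Lower) (6, Upper))"
    unfolding E2_def \<Omega>_def[symmetric] by (intro prob_less) (simp_all add: \<Omega>)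
  moreover have "1 \<in> ?V" "6 \<in> ?V" "?T \<subseteq> ?V" by (auto simp: path_verts_def)
  ultimately show ?thesis using finite_simple_graph_path by blast
qed

subsection \<open>Bond percolation on hypergraphs\<close>

definition hyper_verts :: "nat \<Rightarrow> nat set" where
  "hyper_verts m = {..6} \<union> hubs m"

text \<open>Hyperedge \<open>k\<close> is site \<open>k\<close>, and vertex \<open>i\<close> is the
  joint between the hyperedges \<open>i\<close> and \<open>i + 1\<close>, so its vertical edge is
  the link there; the vertices 0 and 6 are the ends. Since the hubs lie inside the hyperedges, a
  bundle consists only of the vertical edges at three hubs.\<close>

definition hyperedge :: "nat \<Rightarrow> nat \<Rightarrow> nat set" where
  "hyperedge m k = {k - 1, k} \<union> (\<lambda>c. hub c (group k)) ` {..<m}"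

definition hyperedges :: "nat \<Rightarrow> nat set set" where
  "hyperedges m = hyperedge m ` {1..6}"

lemma finite_hypergraph_hyper: "finite_hypergraph (hyper_verts m) (hyperedges m)"
proof -
  have "hub c (group i) \<in> hubs m" if "c < m" for c i
    using that group_less_3 unfolding hubs_def by blast
  then show ?thesis
    by (auto simp: finite_hypergraph_def hyper_verts_def hyperedges_def hyperedge_def)
qed

lemma mem_hyperedge_joint: "v \<le> 6 \<Longrightarrow> v \<in> hyperedge m k \<longleftrightarrow> v = k - 1 \<or> v = k"
  by (auto simp: hyperedge_def hub_def)

lemma mem_hyperedge_hub: "v \<in> hyperedge m k \<Longrightarrow> k \<le> 6 \<Longrightarrow> 7 \<le> v \<Longrightarrow> colour v = group k"
  by (auto simp: hyperedge_def)

lemma inj_on_hyperedge: "inj_on (hyperedge m) {1..6}"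
proof (rule inj_onI)
  fix k k' assume k: "k \<in> {1..6}" "k' \<in> {1..6}" and eq: "hyperedge m k = hyperedge m k'"
  have "k \<in> hyperedge m k" "k' \<in> hyperedge m k'" by (simp_all add: hyperedge_def)
  then have "k \<in> hyperedge m k'" "k' \<in> hyperedge m k" by (simp_all add: eq)
  with k show "k = k'" by (auto simp: mem_hyperedge_joint)
qed

lemma horizontal_inject: "e \<noteq> {} \<Longrightarrow> horizontal s e = horizontal t f \<longleftrightarrow> s = t \<and> e = f"
proof
  assume "e \<noteq> {}" and eq: "horizontal s e = horizontal t f"
  then obtain v where "v \<in> e" by blast
  then have "(v, s) \<in> horizontal t f" unfolding eq[symmetric] by simp
  then have "s = t" by simp
  moreover have "v \<in> e \<longleftrightarrow> v \<in> f" for v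
  proof -
    have "v \<in> e \<longleftrightarrow> (v, s) \<in> horizontal s e" by simp
    also have "\<dots> \<longleftrightarrow> v \<in> f" unfolding eq using \<open>s = t\<close> by simp
    finally show ?thesis .
  qed
  ultimately show "s = t \<and> e = f" by blast
qed simp

lemma horizontal_neq_vertical: "horizontal s e \<noteq> vertical v"
proof
  assume eq: "horizontal s e = vertical v"
  have "(v, flip s) \<in> horizontal s e" unfolding eq by simp
  then show False by (cases s) auto
qed

lemma vertical_inject [simp]: "vertical v = vertical w \<longleftrightarrow> v = w"
  by (auto simp: vertical_def doubleton_eq_iff)

definition site_edge :: "nat \<Rightarrow> nat \<times> bunk \<Rightarrow> (nat \<times> bunk) set" where
  "site_edge m = (\<lambda>(k, s). horizontal s (hyperedge m k))"

lemma inj_on_site_edge: "inj_on (site_edge m) (sites 6)"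
proof (rule inj_onI)
  fix p q assume pq: "p \<in> sites 6" "q \<in> sites 6" "site_edge m p = site_edge m q"
  obtain k s k' s' where p: "p = (k, s)" and q: "q = (k', s')" by (cases p, cases q)
  have "hyperedge m k \<noteq> {}" by (simp add: hyperedge_def)
  with pq(3) have "s = s'" "hyperedge m k = hyperedge m k'"
    by (simp_all add: p q site_edge_def horizontal_inject)
  with pq show "p = q"
    using inj_onD[OF inj_on_hyperedge] by (simp add: p q sites_def)
qed

lemma bunkbed_edges_hyper:
  "bunkbed_edges (hyper_verts m) (hyperedges m) =
    site_edge m ` sites 6 \<union> vertical ` {..6} \<union> vertical ` hubs m"
  by (auto simp: bunkbed_edges_def hyper_verts_def hyperedges_def site_edge_def sites_def UNIV_bunk)

text \<open>As for site percolation, incomplete copies are harmless because hubs are controlled by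
  colour alone. The new point is that a joint is itself a vertex on two levels, where a path may
  switch level only along the link.\<close>

lemma connects_hyper_iff:
  assumes X: "X \<subseteq> bunkbed_edges (hyper_verts m) (hyperedges m)"
    and c: "c < m" "vertical ` hub c ` {..<3} \<subseteq> X"
  shows "connects X (0, Lower) (6, l) \<longleftrightarrow>
    tied6 (joined (levels 6 {p \<in> sites 6. site_edge m p \<in> X} l) (\<lambda>i. i \<le> 6 \<and> vertical i \<in> X))"
proof -
  define a where
    "a = joined (levels 6 {p \<in> sites 6. site_edge m p \<in> X} l) (\<lambda>i. i \<le> 6 \<and> vertical i \<in> X)"
  define S where "S k = {s. horizontal s (hyperedge m k) \<in> X}" for k
  let ?R = "shares_edge X"
  have lev: "levels 6 {p \<in> sites 6. site_edge m p \<in> X} l i = S i" if "i \<in> {1..6}" for i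
    using that by (auto simp: levels_def sites_def site_edge_def S_def)
  have a: "a i \<longleftrightarrow> S i \<inter> S (Suc i) \<noteq> {} \<or> vertical i \<in> X \<and> S i \<noteq> {} \<and> S (Suc i) \<noteq> {}"
    if "i \<in> {1..5}" for i
    using that lev[of i] lev[of "Suc i"] by (simp add: a_def joined_def)
  have a0: "a 0 \<longleftrightarrow> Lower \<in> S 1 \<or> vertical 0 \<in> X \<and> S 1 \<noteq> {}"
    and a6: "a 6 \<longleftrightarrow> l \<in> S 6 \<or> vertical 6 \<in> X \<and> S 6 \<noteq> {}"
    using lev[of 1] lev[of 6] by (auto simp: a_def joined_def levels_def[of _ _ _ 0] levels_def[of _ _ _ 7])
  have sym: "?R\<^sup>*\<^sup>* x y \<Longrightarrow> ?R\<^sup>*\<^sup>* y x" for x y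
    using symp_rtranclp[OF symp_shares_edge] by (rule sympD)
  have siteR: "?R\<^sup>*\<^sup>* (v, s) (hub c (group k), Lower)" if "s \<in> S k" "v \<in> hyperedge m k" for v s k
  proof -
    have "hub c (group k) \<in> hyperedge m k" using c(1) by (simp add: hyperedge_def)
    then have "?R (v, s) (hub c (group k), s)"
      using that by (intro shares_edgeI[of "horizontal s (hyperedge m k)"]) (auto simp: S_def)
    moreover have "?R (hub c (group k), s) (hub c (group k), Lower)"
      using c(2) by (intro shares_edge_vertical) auto
    ultimately show ?thesis by auto
  qed
  have vertR: "?R\<^sup>*\<^sup>* (v, s) (v, t)" if "vertical v \<in> X" for v s t
    using shares_edge_vertical[OF that] by auto
  have "?R\<^sup>*\<^sup>* (0, Lower) (6, l)" if "tied6 a"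
    using that symp_shares_edge
  proof (rule tied6_imp_rtranclp[where H = "\<lambda>g. (hub c g, Lower)"])
    show "?R\<^sup>*\<^sup>* (0, Lower) (hub c 0, Lower)" if "a 0"
    proof -
      note joint = that
      obtain s where s: "s \<in> S 1" "s = Lower \<or> vertical 0 \<in> X"
        using joint unfolding a0 by blast
      then have "?R\<^sup>*\<^sup>* (0, Lower) (0, s)" using vertR[of 0] by auto
      also have "?R\<^sup>*\<^sup>* (0, s) (hub c 0, Lower)"
        using siteR[OF s(1), of 0] by (simp add: mem_hyperedge_joint)
      finally show ?thesis .
    qed
    show "?R\<^sup>*\<^sup>* (hub c 2, Lower) (6, l)" if "a 6"
    proof -
      note joint = that
      obtain s where s: "s \<in> S 6" "s = l \<or> vertical 6 \<in> X"
        using joint unfolding a6 by blast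
      then have "?R\<^sup>*\<^sup>* (6, l) (6, s)" using vertR[of 6] by auto
      also have "?R\<^sup>*\<^sup>* (6, s) (hub c 2, Lower)"
        using siteR[OF s(1), of 6] by (simp add: mem_hyperedge_joint)
      finally show ?thesis by (rule sym)
    qed
    show "?R\<^sup>*\<^sup>* (hub c (group i), Lower) (hub c (group (Suc i)), Lower)" if i: "i \<in> {1..5}" "a i" for i
    proof -
      obtain s t where st: "s \<in> S i" "t \<in> S (Suc i)" "s = t \<or> vertical i \<in> X"
        using i a by blast
      have "i \<in> hyperedge m i" "i \<in> hyperedge m (Suc i)"
        using i(1) by (auto simp: mem_hyperedge_joint)
      then have "?R\<^sup>*\<^sup>* (i, s) (hub c (group i), Lower)" "?R\<^sup>*\<^sup>* (i, t) (hub c (group (Suc i)), Lower)"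
        using siteR st by blast+
      moreover have "?R\<^sup>*\<^sup>* (i, s) (i, t)" using st(3) vertR by auto
      ultimately show ?thesis using sym by (meson rtranclp_trans)
    qed
  qed
  moreover have "tied6 a" if R: "?R\<^sup>*\<^sup>* (0, Lower) (6, l)"
  proof -
    \<comment> \<open>At a joint the invariant remembers a retained hyperedge \<open>k\<close> that
      led there, and admits a level outside \<open>S k\<close> only through the link; the start
      vertex, reached without any hyperedge, is a separate case.\<close>
    define P where "P v s \<longleftrightarrow>
      (if 7 \<le> v then reached a (colour v)
       else v = 0 \<and> (s = Lower \<or> vertical 0 \<in> X) \<or>
         (\<exists>k\<in>{1..6}. v \<in> hyperedge m k \<and> reached a (group k) \<and> S k \<noteq> {} \<and> (s \<in> S k \<or> vertical v \<in> X)))" for v s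
    have "P (fst x) (snd x)" if "?R\<^sup>*\<^sup>* (0, Lower) x" for x
      using that
    proof (induction rule: rtranclp_induct)
      case base
      show ?case by (simp add: P_def)
    next
      case (step x y)
      then obtain e where e: "e \<in> X" "x \<in> e" "y \<in> e" by (auto simp: shares_edge_def)
      obtain v s w t where xy: "x = (v, s)" "y = (w, t)" by (cases x, cases y)
      from e(1) X have "e \<in> bunkbed_edges (hyper_verts m) (hyperedges m)" by blast
      then have "P w t"
      proof (cases rule: bunkbed_edgesE)
        case (1 r e')
        then obtain k where k: "k \<in> {1..6}" "e = horizontal r (hyperedge m k)"
          by (auto simp: hyperedges_def)
        with e have r: "r \<in> S k" "s = r" "t = r" and vw: "v \<in> hyperedge m k" "w \<in> hyperedge m k"
          by (auto simp: S_def xy)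
        have Pv: "P v r" using step.IH by (simp add: xy r)
        have "reached a (group k)"
        proof (cases "7 \<le> v")
          case True
          with Pv vw k(1) show ?thesis by (simp add: P_def mem_hyperedge_hub)
        next
          case False
          with Pv have "v = 0 \<and> (r = Lower \<or> vertical 0 \<in> X) \<or>
              (\<exists>k\<in>{1..6}. v \<in> hyperedge m k \<and> reached a (group k) \<and> S k \<noteq> {} \<and> (r \<in> S k \<or> vertical v \<in> X))"
            by (simp only: P_def if_False)
          then consider "v = 0" "r = Lower \<or> vertical 0 \<in> X"
            | k' where "k' \<in> {1..6}" "v \<in> hyperedge m k'" "reached a (group k')" "S k' \<noteq> {}"
                "r \<in> S k' \<or> vertical v \<in> X"
            by blast
          then show ?thesis
          proof cases
            case 1
            with vw(1) k(1) have "k = 1" by (auto simp: mem_hyperedge_joint)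
            with 1 r(1) have "a 0" unfolding a0 by blast
            with \<open>k = 1\<close> show ?thesis by (simp add: reached_def)
          next
            case (2 k')
            have "v = k - 1 \<or> v = k" "v = k' - 1 \<or> v = k'"
              using False vw(1) 2(2) by (simp_all add: mem_hyperedge_joint)
            \<comment> \<open>A joint lies only in the hyperedges on its two sides, so the arriving
              and the leaving hyperedge coincide or are neighbours; in the latter case their joint
              is intact.\<close>
            with k(1) 2(1) consider "k' = k" | "k = Suc k'" "v = k'" "k' \<in> {1..5}" | "k' = Suc k" "v = k" "k \<in> {1..5}"
              by fastforce
            then show ?thesis
            proof cases
              case 2
              moreover from 2 have "a k'" using a[of k'] r(1) \<open>S k' \<noteq> {}\<close> \<open>r \<in> S k' \<or> vertical v \<in> X\<close> by blast
              ultimately show ?thesis using reached_Suc[of k' a] \<open>reached a (group k')\<close> by simp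
            next
              case 3
              moreover from 3 have "a k" using a[of k] r(1) \<open>S k' \<noteq> {}\<close> \<open>r \<in> S k' \<or> vertical v \<in> X\<close> by blast
              ultimately show ?thesis using reached_Suc[of k a] \<open>reached a (group k')\<close> by simp
            qed (use 2 in simp)
          qed
        qed
        with r k(1) vw(2) show ?thesis
          by (auto simp: P_def mem_hyperedge_hub)
      next
        case (2 x)
        with e step.IH have "w = v" "vertical v \<in> X" "P v s" by (auto simp: xy)
        then show ?thesis by (auto simp: P_def split: if_splits)
      qed
      then show ?case by (simp add: xy)
    qed
    from this[OF R] have "P 6 l" by simp
    then have "\<exists>k\<in>{1..6}. 6 \<in> hyperedge m k \<and> reached a (group k) \<and> S k \<noteq> {} \<and> (l \<in> S k \<or> vertical 6 \<in> X)"
      by (simp add: P_def)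
    then obtain k where k: "k \<in> {1..6}" "6 \<in> hyperedge m k" "reached a (group k)" "S k \<noteq> {}"
        "l \<in> S k \<or> vertical 6 \<in> X"
      by blast
    then have "k = 6" by (auto simp: mem_hyperedge_joint)
    with k show ?thesis by (auto simp: tied6_iff_reached a6)
  qed
  ultimately show ?thesis
    unfolding connects_iff a_def[symmetric] by blast
qed

lemma E5_counterexample:
  "\<exists>(V :: nat set) E. finite_hypergraph V E \<and> (\<exists>u\<in>V. \<exists>v\<in>V.
     \<P>(X in E5 V E. connects X (u, Lower) (v, Lower))
       < \<P>(X in E5 V E. connects X (u, Lower) (v, Upper)))"
proof -
  \<comment> \<open>The exponent 19 counts 6 sites on two levels and the 7 possible links at the
    vertices 0 to 6.\<close>
  obtain m :: nat where m: "(2 ^ 19 + 1) * (2 ^ 3 - 1) ^ m < (2 ^ 3 :: nat) ^ m"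
    using ex_bundle_number[of "2 ^ 19" 3] by blast
  let ?V = "hyper_verts m" and ?E = "hyperedges m"
  let ?K = "(vertical :: nat \<Rightarrow> _) ` {..6}" and ?B = "\<lambda>c. vertical ` hub c ` {..<3}"
  let ?ev = "\<lambda>l X. connects X (0, Lower) (6, l)"
  have inj_vertical: "inj_on vertical A" for A :: "nat set" by (auto simp: inj_on_def)
  have cK: "card ?K = 7" by (simp add: card_image inj_vertical)
  have "card {X \<in> Pow (bunkbed_edges ?V ?E). ?ev Lower X} < card {X \<in> Pow (bunkbed_edges ?V ?E). ?ev Upper X}"
  proof (rule card_less_of_bundles[where h = "site_edge m" and K = ?K and n = 6 and k = 3 and m = m
        and B = ?B and J = "\<lambda>L i. i \<le> 6 \<and> vertical i \<in> L" and Q = tied6])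
    show "finite (?B c) \<and> card (?B c) = 3" for c
    proof -
      have "inj_on (hub c) {..<3}" by (auto simp: inj_on_def hub_def)
      then show ?thesis by (simp add: card_image inj_vertical)
    qed
    show "disjoint_family_on ?B {..<m}"
      by (auto simp: disjoint_family_on_def hub_inject)
    show "site_edge m ` sites 6 \<inter> ?K = {}"
      by (auto simp: site_edge_def horizontal_neq_vertical)
    show "(site_edge m ` sites 6 \<union> ?K) \<inter> ?B c = {}" for c
      by (auto simp: site_edge_def horizontal_neq_vertical horizontal_neq_vertical[symmetric] hub_def)
    show "bunkbed_edges ?V ?E = site_edge m ` sites 6 \<union> ?K \<union> (\<Union>c<m. ?B c)"
      by (simp add: bunkbed_edges_hyper hubs_eq_UN image_UN)
    show "(2 ^ (2 * 6 + card ?K) + 1) * (2 ^ 3 - 1) ^ m < (2 ^ 3 :: nat) ^ m"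
      using m by (simp add: cK)
    show "?ev l X \<longleftrightarrow> tied6 (joined (levels 6 {p \<in> sites 6. site_edge m p \<in> X} l)
        (\<lambda>i. i \<le> 6 \<and> vertical i \<in> X \<inter> ?K))"
      if "X \<subseteq> bunkbed_edges ?V ?E" "c < m" "?B c \<subseteq> X" for X l c
    proof -
      have "(\<lambda>i. i \<le> 6 \<and> vertical i \<in> X \<inter> ?K) = (\<lambda>i. i \<le> 6 \<and> vertical i \<in> X)" by auto
      then show ?thesis using connects_hyper_iff[OF that] by simp
    qed
  qed (use inj_on_site_edge card_single_tied6 in auto)
  then have "\<P>(X in E5 ?V ?E. connects X (0, Lower) (6, Lower))
      < \<P>(X in E5 ?V ?E. connects X (0, Lower) (6, Upper))"
    unfolding E5_def by (intro prob_less_id) (simp_all add: bunkbed_edges_hyper)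
  moreover have "0 \<in> ?V" "6 \<in> ?V" by (auto simp: hyper_verts_def)
  ultimately show ?thesis using finite_hypergraph_hyper by blast
qed

text \<open>Choosing the hubs as \<open>T\<close> retains all their vertical edges and at the same
  time excludes every link at a joint.\<close>

lemma E4_counterexample:
  "\<exists>(V :: nat set) E T. finite_hypergraph V E \<and> T \<subseteq> V \<and> (\<exists>u\<in>V. \<exists>v\<in>V.
     \<P>(X in E4 V E T. connects X (u, Lower) (v, Lower))
       < \<P>(X in E4 V E T. connects X (u, Lower) (v, Upper)))"
proof -
  let ?V = "hyper_verts (Suc 0)" and ?E = "hyperedges (Suc 0)" and ?T = "hubs (Suc 0)"
  let ?h = "site_edge (Suc 0)"
  let ?ev = "\<lambda>l X. connects X (0, Lower) (6, l)"
  define \<Omega> where "\<Omega> = {X. X \<subseteq> bunkbed_edges ?V ?E \<and>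
     (\<forall>e\<in>?E. horizontal Lower e \<in> X \<longleftrightarrow> horizontal Upper e \<notin> X) \<and>
     (\<forall>v\<in>?V. vertical v \<in> X \<longleftrightarrow> v \<in> ?T)}"
  have VT: "?V = {..6} \<union> ?T" "{..6} \<inter> ?T = {}"
    by (auto simp: hyper_verts_def dest: hubs_ge_7)
  have disj: "?h ` sites 6 \<inter> vertical ` A = {}" for A
    by (auto simp: site_edge_def horizontal_neq_vertical)
  have \<Omega>_iff: "X \<in> \<Omega> \<longleftrightarrow> (\<exists>Y\<in>single 6. X = ?h ` Y \<union> vertical ` ?T)" for X
  proof
    assume X: "X \<in> \<Omega>"
    let ?Y = "{p \<in> sites 6. ?h p \<in> X}"
    have "X \<subseteq> bunkbed_edges ?V ?E" using X by (simp add: \<Omega>_def)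
    then have sub: "X \<subseteq> ?h ` sites 6 \<union> vertical ` {..6} \<union> vertical ` ?T"
      by (simp only: bunkbed_edges_hyper)
    have vert: "vertical v \<in> X \<longleftrightarrow> v \<in> ?T" if "v \<in> {..6} \<union> ?T" for v
      using X that by (simp add: \<Omega>_def VT(1))
    have "X = ?h ` ?Y \<union> vertical ` ?T"
    proof (intro equalityI subsetI)
      fix e assume e: "e \<in> X"
      with sub consider p where "p \<in> sites 6" "e = ?h p" | v where "v \<in> {..6} \<union> ?T" "e = vertical v"
        by blast
      then show "e \<in> ?h ` ?Y \<union> vertical ` ?T"
        using e vert by cases auto
    next
      fix e assume "e \<in> ?h ` ?Y \<union> vertical ` ?T"
      then show "e \<in> X" using vert by auto
    qed
    moreover have "?Y \<in> single 6"
      using X by (auto simp: \<Omega>_def single_def sites_def site_edge_def hyperedges_def)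
    ultimately show "\<exists>Y\<in>single 6. X = ?h ` Y \<union> vertical ` ?T" by (rule bexI)
  next
    assume "\<exists>Y\<in>single 6. X = ?h ` Y \<union> vertical ` ?T"
    then obtain Y where Y: "Y \<in> single 6" and X: "X = ?h ` Y \<union> vertical ` ?T" by blast
    have sub: "Y \<subseteq> sites 6" using Y by (simp add: single_def)
    have mem: "horizontal s (hyperedge (Suc 0) k) \<in> X \<longleftrightarrow> (k, s) \<in> Y" if "k \<in> {1..6}" for k s
    proof -
      have ks: "(k, s) \<in> sites 6" using that by (simp add: sites_def)
      have "?h (k, s) \<in> ?h ` Y \<longleftrightarrow> (k, s) \<in> Y"
        by (rule inj_on_image_mem_iff[OF inj_on_site_edge ks sub])
      then show ?thesis by (auto simp: X site_edge_def horizontal_neq_vertical)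
    qed
    have "vertical v \<in> X \<longleftrightarrow> v \<in> ?T" for v
      by (auto simp: X site_edge_def horizontal_neq_vertical[symmetric])
    moreover have "X \<subseteq> bunkbed_edges ?V ?E"
      using sub by (auto simp: X bunkbed_edges_hyper)
    ultimately show "X \<in> \<Omega>"
      using Y mem by (auto simp: \<Omega>_def hyperedges_def single_def)
  qed
  have \<Omega>: "\<Omega> = (\<lambda>Y. ?h ` Y \<union> vertical ` ?T) ` single 6"
    by (rule set_eqI) (simp only: \<Omega>_iff image_iff)
  have "card {X \<in> \<Omega>. ?ev Lower X} < card {X \<in> \<Omega>. ?ev Upper X}"
  proof (rule card_less_of_single[OF inj_on_site_edge disj card_single_tied6 \<Omega>])
    show "?ev l (?h ` Y \<union> vertical ` ?T) \<longleftrightarrow> tied6 (joined (levels 6 Y l) (\<lambda>_. False))"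
      if "Y \<in> single 6" for Y l
    proof -
      let ?X = "?h ` Y \<union> vertical ` ?T"
      have Y: "Y \<subseteq> sites 6" using that by (simp add: single_def)
      have "?h p \<in> ?X \<longleftrightarrow> p \<in> Y" if "p \<in> sites 6" for p
        using inj_on_image_mem_iff[OF inj_on_site_edge that Y] disj[of ?T] that by blast
      then have "{p \<in> sites 6. ?h p \<in> ?X} = Y"
        using Y by blast
      moreover have "(\<lambda>i. i \<le> 6 \<and> vertical i \<in> ?X) = (\<lambda>_. False)"
      proof
        fix i
        have "vertical i \<notin> ?h ` Y"
          by (auto simp: site_edge_def horizontal_neq_vertical[symmetric])
        moreover have "vertical i \<notin> vertical ` ?T" if "i \<le> 6"
          using that by (auto dest: hubs_ge_7)
        ultimately show "(i \<le> 6 \<and> vertical i \<in> ?X) = False" by blast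
      qed
      moreover have "?X \<subseteq> bunkbed_edges ?V ?E"
        using Y by (auto simp: bunkbed_edges_hyper)
      ultimately show ?thesis
        using connects_hyper_iff[of ?X "Suc 0" 0 l] by (auto simp: hubs_1)
    qed
  qed
  then have "\<P>(X in E4 ?V ?E ?T. connects X (0, Lower) (6, Lower))
      < \<P>(X in E4 ?V ?E ?T. connects X (0, Lower) (6, Upper))"
    unfolding E4_def \<Omega>_def[symmetric] by (intro prob_less_id) (simp_all add: \<Omega>)
  moreover have "0 \<in> ?V" "6 \<in> ?V" "?T \<subseteq> ?V" by (auto simp: hyper_verts_def)
  ultimately show ?thesis using finite_hypergraph_hyper by blast
qed

subsection \<open>Bond percolation on digraphs\<close>

text \<open>
  In the digraph \<open>gadget m\<close> the arcs 1 to 4 are the sites of the chain; the remaining arcs come in \<open>m\<close>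
  bundles of 9, and the chain runs from vertex 0 to vertex 4.
\<close>

definition coin_ends :: "(nat \<times> nat) list" where
  "coin_ends = [(0, 5), (1, 2), (3, 6), (5, 4)]"

text \<open>Passing a hub makes the level free: vertex 1 is always available on both levels, vertex
  5 once it is reached, and vertex 4 once vertex 6 is reached. The way through hub 0 and that
  through hub 2 are one-way, so this freedom does not flow back to the end 0, nor is it open to
  whoever merely reaches the end 4. The arcs \<open>(2, 0)\<close>, \<open>(2, 3)\<close> and
  \<open>(4, 3)\<close> keep the level and realise the joints 1, 2 and 3.\<close>

definition bundle_ends :: "nat \<Rightarrow> (nat \<times> nat) list" where
  "bundle_ends c =
    [(0, hub c 0), (hub c 0, 1), (2, 0), (2, 3), (4, 3),
     (5, hub c 1), (hub c 1, 5), (6, hub c 2), (hub c 2, 4)]"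

definition ends :: "nat \<Rightarrow> nat \<times> nat" where
  "ends a = (if a < 5 then coin_ends ! (a - 1) else bundle_ends ((a - 5) div 9) ! ((a - 5) mod 9))"

definition bundle_arcs :: "nat \<Rightarrow> nat set" where
  "bundle_arcs c = {5 + 9 * c..<14 + 9 * c}"

definition gadget :: "nat \<Rightarrow> (nat, nat) pre_digraph" where
  "gadget m = \<lparr>verts = {..6} \<union> hubs m, arcs = {1..<5 + 9 * m}, tail = fst \<circ> ends, head = snd \<circ> ends\<rparr>"

lemma arcs_gadget: "arcs (gadget m) = {1..4} \<union> (\<Union>c<m. bundle_arcs c)"
proof (intro equalityI subsetI)
  fix a assume a: "a \<in> arcs (gadget m)"
  show "a \<in> {1..4} \<union> (\<Union>c<m. bundle_arcs c)"
  proof (cases "a < 5")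
    case False
    then have "a \<in> bundle_arcs ((a - 5) div 9)" "(a - 5) div 9 < m"
      using a by (auto simp: gadget_def bundle_arcs_def)
    then show ?thesis by blast
  qed (use a in \<open>auto simp: gadget_def\<close>)
qed (auto simp: gadget_def bundle_arcs_def)

lemma ends_bundle:
  assumes "a \<in> bundle_arcs c"
  shows "ends a = bundle_ends c ! (a - (5 + 9 * c))" "a - (5 + 9 * c) < 9"
proof -
  obtain r where "a = 5 + 9 * c + r" "r < 9"
  proof
    show "a = 5 + 9 * c + (a - (5 + 9 * c))" "a - (5 + 9 * c) < 9"
      using assms by (auto simp: bundle_arcs_def)
  qed
  then have "(a - 5) div 9 = c" "(a - 5) mod 9 = a - (5 + 9 * c)" by simp_all
  with assms show "ends a = bundle_ends c ! (a - (5 + 9 * c))" "a - (5 + 9 * c) < 9"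
    by (auto simp: bundle_arcs_def ends_def)
qed

lemma length_bundle_ends: "length (bundle_ends c) = 9"
  by (simp add: bundle_ends_def)

lemma ends_bundle_mem: "a \<in> bundle_arcs c \<Longrightarrow> ends a \<in> set (bundle_ends c)"
  using ends_bundle[of a c] length_bundle_ends[of c] by simp

lemma bundle_ends_arc:
  assumes "p \<in> set (bundle_ends c)"
  obtains a where "a \<in> bundle_arcs c" "ends a = p"
proof -
  from assms obtain r where r: "r < 9" "p = bundle_ends c ! r"
    by (auto simp: in_set_conv_nth length_bundle_ends)
  then have "5 + 9 * c + r \<in> bundle_arcs c" by (simp add: bundle_arcs_def)
  with ends_bundle(1)[OF this] r that show ?thesis by simp
qed

lemma ends_coin:
  "ends 1 = (0, 5)" "ends 2 = (1, 2)" "ends 3 = (3, 6)" "ends 4 = (5, 4)"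
  by (simp_all add: ends_def coin_ends_def)

lemma cases_1_to_4:
  assumes "a \<in> {1..4}"
  obtains "a = 1" | "a = 2" | "a = 3" | "a = (4 :: nat)"
  using assms by force

lemma hub_mem_hubs: "c < m \<Longrightarrow> g < 3 \<Longrightarrow> hub c g \<in> hubs m"
  unfolding hubs_def by blast

lemma ends_gadget:
  assumes "a \<in> arcs (gadget m)"
  shows "fst (ends a) \<in> verts (gadget m)" "snd (ends a) \<in> verts (gadget m)" "fst (ends a) \<noteq> snd (ends a)"
proof -
  have "fst (ends a) \<in> verts (gadget m) \<and> snd (ends a) \<in> verts (gadget m) \<and> fst (ends a) \<noteq> snd (ends a)"
    using assms unfolding arcs_gadget
  proof (elim UnE UN_E)
    assume "a \<in> {1..4}"
    then show ?thesis
      by (rule cases_1_to_4) (simp_all add: ends_coin gadget_def del: One_nat_def)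
  next
    fix c assume "c \<in> {..<m}" "a \<in> bundle_arcs c"
    then have "ends a \<in> set (bundle_ends c)" "hub c 0 \<in> hubs m" "hub c 1 \<in> hubs m" "hub c 2 \<in> hubs m"
      by (simp_all add: ends_bundle_mem hub_mem_hubs)
    moreover have "hub c g \<noteq> v" "v \<noteq> hub c g" if "v \<le> 6" for g v
      using that by (auto simp: hub_def)
    ultimately show ?thesis
      by (auto simp: bundle_ends_def gadget_def)
  qed
  then show "fst (ends a) \<in> verts (gadget m)" "snd (ends a) \<in> verts (gadget m)" "fst (ends a) \<noteq> snd (ends a)"
    by auto
qed

lemma gadget_simps:
  "verts (gadget m) = {..6} \<union> hubs m" "tail (gadget m) a = fst (ends a)" "head (gadget m) a = snd (ends a)"
  by (simp_all add: gadget_def)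

lemma fin_digraph_gadget: "fin_digraph (gadget m)"
proof
  fix a assume "a \<in> arcs (gadget m)"
  then show "tail (gadget m) a \<in> verts (gadget m)" "head (gadget m) a \<in> verts (gadget m)"
    using ends_gadget(1,2) unfolding gadget_simps by blast+
qed (simp_all add: gadget_def)

text \<open>With one bundle the 13 arcs have distinct pairs of ends. Further bundles would repeat
  \<open>(2, 0)\<close>, \<open>(2, 3)\<close> and \<open>(4, 3)\<close>, which do not depend on
  \<open>c\<close>; this is why the amplified gadget is a multigraph.\<close>

lemma digraph_gadget: "digraph (gadget (Suc 0))"
proof -
  interpret fin_digraph "gadget (Suc 0)" by (rule fin_digraph_gadget)
  have "distinct (map ends [1..<14])" by code_simp
  then have "inj_on ends (set [1..<14])"
    unfolding distinct_map by (rule conjunct2)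
  then have inj: "inj_on ends (arcs (gadget (Suc 0)))"
    by (simp add: gadget_def)
  show ?thesis
  proof
    fix a assume "a \<in> arcs (gadget (Suc 0))"
    then show "tail (gadget (Suc 0)) a \<noteq> head (gadget (Suc 0)) a"
      using ends_gadget(3) unfolding gadget_simps by blast
  next
    fix a b assume ab: "a \<in> arcs (gadget (Suc 0))" "b \<in> arcs (gadget (Suc 0))"
      and "arc_to_ends (gadget (Suc 0)) a = arc_to_ends (gadget (Suc 0)) b"
    then have "ends a = ends b"
      by (simp add: arc_to_ends_def gadget_simps prod_eq_iff)
    with inj ab show "a = b" by (simp add: inj_on_eq_iff)
  qed
qed

section \<open>Bunkbed arcs of the gadget and directed connectivity\<close>

definition coin :: "nat \<times> bunk \<Rightarrow> (nat, nat) bunkbed_arc" where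
  "coin = (\<lambda>(i, s). Horizontal s i)"

definition hub_bundle :: "nat \<Rightarrow> (nat, nat) bunkbed_arc set" where
  "hub_bundle c = coin ` (bundle_arcs c \<times> UNIV) \<union> Vertical ` hub c ` {..<3}"

lemma inj_on_coin: "inj_on coin A"
  by (auto simp: inj_on_def coin_def)

lemma mem_coin_image: "Horizontal s a \<in> coin ` Y \<longleftrightarrow> (a, s) \<in> Y" "Vertical v \<notin> coin ` Y"
  by (force simp: coin_def)+

lemma mem_hub_bundle:
  "Horizontal s a \<in> hub_bundle c \<longleftrightarrow> a \<in> bundle_arcs c"
  "Vertical v \<in> hub_bundle c \<longleftrightarrow> v \<in> hub c ` {..<3}"
  by (auto simp: hub_bundle_def coin_def)

lemma disjoint_bunkbed_arcsI:
  assumes "\<And>s a. Horizontal s a \<in> A \<Longrightarrow> Horizontal s a \<notin> B" "\<And>v. Vertical v \<in> A \<Longrightarrow> Vertical v \<notin> B"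
  shows "A \<inter> B = {}"
proof (rule equals0I)
  fix x assume "x \<in> A \<inter> B"
  with assms show False by (cases x) auto
qed

lemma bunkbed_arcs_gadget:
  "bunkbed_arcs (gadget m) = coin ` sites 4 \<union> Vertical ` {..6} \<union> (\<Union>c<m. hub_bundle c)"
proof -
  have "bunkbed_arcs (gadget m) = coin ` (arcs (gadget m) \<times> UNIV) \<union> Vertical ` verts (gadget m)"
    by (auto simp: bunkbed_arcs_def coin_def UNIV_bunk)
  also have "\<dots> = coin ` sites 4 \<union> Vertical ` {..6} \<union> (\<Union>c<m. hub_bundle c)"
    unfolding arcs_gadget gadget_simps sites_def hubs_eq_UN hub_bundle_def by blast
  finally show ?thesis .
qed

lemma diconnects_iff: "diconnects D X = (arc_step D X)\<^sup>*\<^sup>*"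
  by (intro ext) (simp add: diconnects_def path_between_iff_rtranclp)

text \<open>In the directed gadget the links of the chain come from the vertical edges at the vertices
  0, 2, 3 and 4.\<close>

definition vertical_links :: "(nat, nat) bunkbed_arc set \<Rightarrow> nat \<Rightarrow> bool" where
  "vertical_links X i \<longleftrightarrow>
     (i = 0 \<and> Vertical 0 \<in> X) \<or>
     (i = 1 \<and> Vertical 2 \<in> X) \<or>
     (i = 2 \<and> (Vertical 2 \<in> X \<or> Vertical 3 \<in> X)) \<or>
     (i = 3 \<and> (Vertical 3 \<in> X \<or> Vertical 4 \<in> X)) \<or>
     (i = 4 \<and> Vertical 4 \<in> X)"

text \<open>Site 1 can be crossed from the start or after site 2, site 3 after site 2 or after site
  4, and site 4 after site 1; the end is reached through site 4 or freely after site 3. This is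
  \<open>tied4\<close>. At the vertices 1, 5 and 6 the adjacent hub frees the level already, so
  \<open>vertical_links\<close> has no entry for them.\<close>

lemma diconnects_gadget_iff:
  assumes X: "X \<subseteq> bunkbed_arcs (gadget m)" and c: "c < m" "hub_bundle c \<subseteq> X"
  shows "diconnects (gadget m) X (0, Lower) (4, l) \<longleftrightarrow>
    tied4 (joined (levels 4 {p \<in> sites 4. coin p \<in> X} l) (vertical_links X))"
proof -
  define a where "a = joined (levels 4 {p \<in> sites 4. coin p \<in> X} l) (vertical_links X)"
  define S where "S i = {s. Horizontal s i \<in> X}" for i
  define V where "V v \<longleftrightarrow> Vertical v \<in> X" for v
  \<comment> \<open>\<open>W\<close> means that arc 1 can be crossed and \<open>Z\<close> that arc 3
    can; they govern the vertices 5 and 6.\<close>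
  define W where "W \<longleftrightarrow> a 0 \<or> a 1"
  define Z where "Z \<longleftrightarrow> a 2 \<or> W \<and> a 3"
  let ?R = "arc_step (gadget m) X"
  have "levels 4 {p \<in> sites 4. coin p \<in> X} l i = S i" if "i \<in> {1..4}" for i
    using that by (auto simp: levels_def sites_def coin_def S_def)
  then have lev: "levels 4 {p \<in> sites 4. coin p \<in> X} l = (\<lambda>i. if i = 0 then {Lower} else
      if i = 5 then {l} else if i \<in> {1..4} then S i else {})"
    by (auto simp: levels_def sites_def fun_eq_iff)
  have a: "a 0 \<longleftrightarrow> Lower \<in> S 1 \<or> V 0 \<and> S 1 \<noteq> {}"
    "a 1 \<longleftrightarrow> S 1 \<inter> S 2 \<noteq> {} \<or> V 2 \<and> S 1 \<noteq> {} \<and> S 2 \<noteq> {}"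
    "a 2 \<longleftrightarrow> S 2 \<inter> S 3 \<noteq> {} \<or> (V 2 \<or> V 3) \<and> S 2 \<noteq> {} \<and> S 3 \<noteq> {}"
    "a 3 \<longleftrightarrow> S 3 \<inter> S 4 \<noteq> {} \<or> (V 3 \<or> V 4) \<and> S 3 \<noteq> {} \<and> S 4 \<noteq> {}"
    "a 4 \<longleftrightarrow> l \<in> S 4 \<or> V 4 \<and> S 4 \<noteq> {}"
    by (simp_all add: a_def joined_def lev vertical_links_def V_def numeral_2_eq_2[symmetric])
  have tied: "tied4 a \<longleftrightarrow> Z \<or> W \<and> a 4"
    by (auto simp: tied4_def Z_def W_def)
  have "?R\<^sup>*\<^sup>* (0, Lower) (4, l)" if "tied4 a"
  proof -
    define r where "r v t \<longleftrightarrow> ?R\<^sup>*\<^sup>* (0, Lower) (v, t)" for v t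
    have r_step: "r w t'" if "r v t" "?R (v, t) (w, t')" for v t w t'
      using that unfolding r_def by (rule rtranclp.rtrancl_into_rtrancl)
    have r0: "r 0 Lower" by (simp add: r_def)
    have arc: "r (snd (ends k)) t" if "r (fst (ends k)) t" "Horizontal t k \<in> X" for k t
      using that(1) by (rule r_step) (use that(2) in \<open>auto simp: arc_step_def gadget_def\<close>)
    have coins: "r 0 t \<Longrightarrow> t \<in> S 1 \<Longrightarrow> r 5 t" "r 1 t \<Longrightarrow> t \<in> S 2 \<Longrightarrow> r 2 t"
      "r 3 t \<Longrightarrow> t \<in> S 3 \<Longrightarrow> r 6 t" "r 5 t \<Longrightarrow> t \<in> S 4 \<Longrightarrow> r 4 t" for t
      using arc[of 1 t] arc[of 2 t] arc[of 3 t] arc[of 4 t]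
      by (simp_all add: ends_coin S_def del: One_nat_def)
    have link: "r v t'" if "r v t" "Vertical v \<in> X" for v t t'
    proof (cases "t = t'")
      case False
      with that(2) have "?R (v, t) (v, t')"
        by (cases t; cases t') (auto simp: arc_step_def)
      with that(1) show ?thesis by (rule r_step)
    qed (use that in simp)
    have bundled: "r w t" if v: "r v t" and vw: "(v, w) \<in> set (bundle_ends c)" for v w t
    proof -
      obtain k where k: "k \<in> bundle_arcs c" "ends k = (v, w)"
        using vw by (rule bundle_ends_arc)
      then have "Horizontal t k \<in> hub_bundle c" by (force simp: hub_bundle_def coin_def)
      with c k v arc[of k t] show ?thesis by auto
    qed
    have hub: "r (hub c g) t'" if "r (hub c g) t" "g < 3" for g t t'
    proof (rule link[OF that(1)])
      have "Vertical (hub c g) \<in> hub_bundle c" using that(2) by (simp add: hub_bundle_def)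
      with c show "Vertical (hub c g) \<in> X" by blast
    qed
    have through: "r w t'" if "r v t" "g < 3" "(v, hub c g) \<in> set (bundle_ends c)"
      "(hub c g, w) \<in> set (bundle_ends c)" for v w g t t'
      using bundled[OF hub[OF bundled]] that by blast
    have r1: "r 1 t" for t
      by (rule through[OF r0, of 0]) (simp_all add: bundle_ends_def)
    have r5: "r 5 t'" if "r 5 t" for t t'
      by (rule through[OF that, of 1]) (simp_all add: bundle_ends_def)
    have r6: "r 4 t'" if "r 6 t" for t t'
      by (rule through[OF that, of 2]) (simp_all add: bundle_ends_def)
    have r2: "r 2 t" if "t \<in> S 2 \<or> V 2 \<and> S 2 \<noteq> {}" for t
      using that coins(2)[OF r1] link[of 2] by (auto simp: V_def)
    have r20: "r 2 t \<Longrightarrow> r 0 t" and r23: "r 2 t \<Longrightarrow> r 3 t" and r43: "r 4 t \<Longrightarrow> r 3 t" for t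
      using bundled[of 2 t 0] bundled[of 2 t 3] bundled[of 4 t 3] by (simp_all add: bundle_ends_def)
    have W: "r 5 t" if W for t
    proof -
      have "\<exists>s\<in>S 1. r 0 s"
        using that r0 r20 r2 link[of 0 Lower] unfolding W_def a V_def by blast
      then show ?thesis using coins(1) r5 by blast
    qed
    have r4: "r 4 t" if W "t \<in> S 4 \<or> V 4 \<and> S 4 \<noteq> {}" for t
      using that(2) coins(4)[OF W[OF that(1)]] link[of 4] by (auto simp: V_def)
    have Z: "r 4 t" if Z for t
    proof -
      have "\<exists>s\<in>S 3. r 3 s"
      proof (cases "a 2")
        case True
        then show ?thesis using r2 r23 link[of 3] unfolding a V_def by blast
      next
        case False
        with that have "a 3" W by (auto simp: Z_def)
        then show ?thesis using r4 r43 link[of 3] unfolding a V_def by blast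
      qed
      then show ?thesis using coins(3) r6 by blast
    qed
    show ?thesis
      using that Z r4[of l] unfolding tied r_def[symmetric] a by blast
  qed
  moreover have "tied4 a" if R: "?R\<^sup>*\<^sup>* (0, Lower) (4, l)"
  proof -
    define P where "P v t \<longleftrightarrow>
      (if v = 0 then t = Lower \<or> V 0 \<or> t \<in> S 2 \<or> V 2 \<and> S 2 \<noteq> {}
       else if v = 1 then True
       else if v = 2 then t \<in> S 2 \<or> V 2 \<and> S 2 \<noteq> {}
       else if v = 3 then t \<in> S 2 \<or> (V 2 \<or> V 3) \<and> S 2 \<noteq> {} \<or>
         W \<and> (t \<in> S 4 \<or> (V 3 \<or> V 4) \<and> S 4 \<noteq> {}) \<or> Z
       else if v = 4 then W \<and> (t \<in> S 4 \<or> V 4 \<and> S 4 \<noteq> {}) \<or> Z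
       else if v = 5 then W
       else if v = 6 then Z
       else (colour v = 1 \<longrightarrow> W) \<and> (colour v = 2 \<longrightarrow> Z))" for v :: nat and t
    have P_hub: "P (hub c 0) t" "P (hub c 1) t \<longleftrightarrow> W" "P (hub c 2) t \<longleftrightarrow> Z" for c t
    proof -
      have "P (hub c g) t \<longleftrightarrow> (colour (hub c g) = 1 \<longrightarrow> W) \<and> (colour (hub c g) = 2 \<longrightarrow> Z)" for g
        by (simp add: P_def hub_def)
      then show "P (hub c 0) t" "P (hub c 1) t \<longleftrightarrow> W" "P (hub c 2) t \<longleftrightarrow> Z" by simp_all
    qed
    have P_vert: "P 0 t \<longleftrightarrow> t = Lower \<or> V 0 \<or> t \<in> S 2 \<or> V 2 \<and> S 2 \<noteq> {}"
      "P 1 t"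
      "P 2 t \<longleftrightarrow> t \<in> S 2 \<or> V 2 \<and> S 2 \<noteq> {}"
      "P 3 t \<longleftrightarrow> t \<in> S 2 \<or> (V 2 \<or> V 3) \<and> S 2 \<noteq> {} \<or>
         W \<and> (t \<in> S 4 \<or> (V 3 \<or> V 4) \<and> S 4 \<noteq> {}) \<or> Z"
      "P 4 t \<longleftrightarrow> W \<and> (t \<in> S 4 \<or> V 4 \<and> S 4 \<noteq> {}) \<or> Z"
      "P 5 t \<longleftrightarrow> W" "P 6 t \<longleftrightarrow> Z" for t
      by (simp_all add: P_def)
    have vertical: "P v t'" if "P v t" "V v" for v t t'
      using that unfolding P_def by (auto split: if_splits)
    have coin: "P (snd (ends k)) t" if "P (fst (ends k)) t" "t \<in> S k" "k \<in> {1..4}" for k t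
      using that(3)
    proof (rule cases_1_to_4)
      assume "k = 1"
      with that have "P 0 t" "t \<in> S 1" by (simp_all add: ends_coin del: One_nat_def)
      then have W unfolding P_vert W_def a by blast
      with \<open>k = 1\<close> show ?thesis by (simp add: ends_coin P_vert del: One_nat_def)
    next
      assume "k = 3"
      with that have "P 3 t" "t \<in> S 3" by (simp_all add: ends_coin)
      then have Z unfolding P_vert Z_def a by blast
      with \<open>k = 3\<close> show ?thesis by (simp add: ends_coin P_vert)
    qed (use that in \<open>simp_all add: ends_coin P_vert\<close>)
    have bundled: "P w t" if "P v t" "(v, w) \<in> set (bundle_ends c)" for v w t c
      using that by (auto simp: bundle_ends_def P_hub P_vert simp del: One_nat_def)
    have "P (fst x) (snd x)" if "?R\<^sup>*\<^sup>* (0, Lower) x" for x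
      using that
    proof (induction rule: rtranclp_induct)
      case base
      show ?case by (simp add: P_vert)
    next
      case (step x y)
      from step.hyps(2) consider t k where "Horizontal t k \<in> X" "x = (fst (ends k), t)" "y = (snd (ends k), t)"
        | v t t' where "V v" "x = (v, t)" "y = (v, t')"
        unfolding arc_step_def V_def by (auto simp: gadget_def)
      then show ?case
      proof cases
        case (1 t k)
        with X have "k \<in> arcs (gadget m)" by (auto simp: bunkbed_arcs_def)
        then consider "k \<in> {1..4}" | c where "k \<in> bundle_arcs c" unfolding arcs_gadget by blast
        then show ?thesis
        proof cases
          case 1
          with \<open>Horizontal t k \<in> X\<close> show ?thesis
            using coin[of k t] step.IH \<open>x = _\<close> \<open>y = _\<close> by (simp add: S_def)
        next
          case (2 c)
          then show ?thesis
            using bundled[of "fst (ends k)" t "snd (ends k)" c] ends_bundle_mem step.IH \<open>x = _\<close> \<open>y = _\<close>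
            by simp
        qed
      next
        case (2 v t t')
        with vertical step.IH show ?thesis by simp
      qed
    qed
    from this[OF R] show ?thesis unfolding tied a by (simp add: P_vert) blast
  qed
  ultimately show ?thesis
    unfolding diconnects_iff a_def[symmetric] by blast
qed

lemma E7_counterexample:
  "\<exists>D :: (nat, nat) pre_digraph. fin_digraph D \<and> (\<exists>u\<in>verts D. \<exists>v\<in>verts D.
     \<P>(X in E7 D. diconnects D X (u, Lower) (v, Lower))
       < \<P>(X in E7 D. diconnects D X (u, Lower) (v, Upper)))"
proof -
  \<comment> \<open>The exponent 15 counts 4 site arcs on two levels and 7 vertical edges; 21 counts
    the 9 arcs of a bundle on two levels and 3 vertical edges at hubs.\<close>
  obtain m :: nat where m: "(2 ^ 15 + 1) * (2 ^ 21 - 1) ^ m < (2 ^ 21 :: nat) ^ m"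
    using ex_bundle_number[of "2 ^ 15" 21] by blast
  let ?D = "gadget m" and ?K = "(Vertical :: nat \<Rightarrow> (nat, nat) bunkbed_arc) ` {..6}"
  let ?ev = "\<lambda>l X. diconnects ?D X (0, Lower) (4, l)"
  have inj_Vertical: "inj_on Vertical A" for A :: "nat set" by (auto simp: inj_on_def)
  have cK: "card ?K = 7" by (simp add: card_image inj_Vertical)
  have card_bundle: "finite (hub_bundle c) \<and> card (hub_bundle c) = 21" for c
  proof -
    have "inj_on (hub c) {..<3}" by (auto simp: inj_on_def hub_def)
    then have "card ((Vertical :: nat \<Rightarrow> (nat, nat) bunkbed_arc) ` hub c ` {..<3}) = 3"
      by (simp add: card_image inj_Vertical)
    moreover have "card (coin ` (bundle_arcs c \<times> UNIV)) = 18"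
      by (simp add: card_image inj_on_coin card_cartesian_product bundle_arcs_def UNIV_bunk)
    moreover have "coin ` (bundle_arcs c \<times> UNIV) \<inter> Vertical ` hub c ` {..<3} = {}"
      by (auto simp: coin_def)
    ultimately show ?thesis
      by (simp add: hub_bundle_def card_Un_disjoint bundle_arcs_def)
  qed
  have "card {X \<in> Pow (bunkbed_arcs ?D). ?ev Lower X} < card {X \<in> Pow (bunkbed_arcs ?D). ?ev Upper X}"
  proof (rule card_less_of_bundles[where h = coin and K = ?K and n = 4 and k = 21 and m = m
        and B = hub_bundle and J = vertical_links and Q = tied4])
    show "disjoint_family_on hub_bundle {..<m}"
      unfolding disjoint_family_on_def
    proof (intro ballI impI disjoint_bunkbed_arcsI)
      fix c c' s a assume "c \<noteq> c'" "Horizontal s a \<in> hub_bundle c"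
      then show "Horizontal s a \<notin> hub_bundle c'"
        by (auto simp: mem_hub_bundle bundle_arcs_def)
    next
      fix c c' v assume "c \<noteq> c'" "Vertical v \<in> hub_bundle c"
      then show "Vertical v \<notin> hub_bundle c'"
        by (auto simp: mem_hub_bundle hub_inject)
    qed
    show "coin ` sites 4 \<inter> ?K = {}"
      by (rule disjoint_bunkbed_arcsI) (auto simp: mem_coin_image)
    show "(coin ` sites 4 \<union> ?K) \<inter> hub_bundle c = {}" for c
      by (rule disjoint_bunkbed_arcsI)
        (auto simp: mem_coin_image mem_hub_bundle bundle_arcs_def sites_def hub_def)
    show "vertical_links {} = (\<lambda>_. False)"
      by (auto simp: vertical_links_def)
    show "vertical_links L = (\<lambda>_. False) \<or> (\<exists>c\<le>4. vertical_links L c)" for L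
    proof -
      have "c \<le> 4" if "vertical_links L c" for c
        using that by (auto simp: vertical_links_def)
      then show ?thesis by blast
    qed
    show "(2 ^ (2 * 4 + card ?K) + 1) * (2 ^ 21 - 1) ^ m < (2 ^ 21 :: nat) ^ m"
      using m by (simp add: cK)
    show "?ev l X \<longleftrightarrow> tied4 (joined (levels 4 {p \<in> sites 4. coin p \<in> X} l) (vertical_links (X \<inter> ?K)))"
      if "X \<subseteq> bunkbed_arcs ?D" "c < m" "hub_bundle c \<subseteq> X" for X l c
    proof -
      have "vertical_links (X \<inter> ?K) = vertical_links X" by (auto simp: vertical_links_def)
      then show ?thesis using diconnects_gadget_iff[OF that] by simp
    qed
  qed (rule card_bundle inj_on_coin card_single_tied4 bunkbed_arcs_gadget | simp)+
  moreover have "finite (bunkbed_arcs ?D)"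
    using card_bundle by (auto simp: bunkbed_arcs_gadget)
  ultimately have "\<P>(X in E7 ?D. diconnects ?D X (0, Lower) (4, Lower))
      < \<P>(X in E7 ?D. diconnects ?D X (0, Lower) (4, Upper))"
    unfolding E7_def by (intro prob_less_id) simp_all
  moreover have "0 \<in> verts ?D" "4 \<in> verts ?D" by (auto simp: gadget_def)
  ultimately show ?thesis using fin_digraph_gadget by blast
qed

text \<open>With the hubs as \<open>T\<close> and the arcs of the only bundle as \<open>F\<close>,
  just the four site arcs choose a level and no link is present.\<close>

lemma E6_counterexample:
  "\<exists>(D :: (nat, nat) pre_digraph) T F.
     digraph D \<and> T \<subseteq> verts D \<and> F \<subseteq> arcs D \<and> (\<exists>u\<in>verts D. \<exists>v\<in>verts D.
     \<P>(X in E6 D T F. diconnects D X (u, Lower) (v, Lower))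
       < \<P>(X in E6 D T F. diconnects D X (u, Lower) (v, Upper)))"
proof -
  let ?D = "gadget (Suc 0)" and ?T = "hubs (Suc 0)" and ?F = "bundle_arcs 0"
  let ?ev = "\<lambda>l X. diconnects ?D X (0, Lower) (4, l)"
  define \<Omega> where "\<Omega> = {X. X \<subseteq> bunkbed_arcs ?D \<and>
     (\<forall>a\<in>?F. Horizontal Lower a \<in> X \<and> Horizontal Upper a \<in> X) \<and>
     (\<forall>a\<in>arcs ?D - ?F. Horizontal Lower a \<in> X \<longleftrightarrow> Horizontal Upper a \<notin> X) \<and>
     (\<forall>v\<in>verts ?D. Vertical v \<in> X \<longleftrightarrow> v \<in> ?T)}"
  have arcs: "arcs ?D - ?F = {1..4}" "?F \<subseteq> arcs ?D"
    by (auto simp: gadget_def bundle_arcs_def)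
  have verts: "verts ?D = {..6} \<union> ?T" "{..6} \<inter> ?T = {}"
    by (auto simp: gadget_def dest: hubs_ge_7)
  have bunkbed: "bunkbed_arcs ?D = coin ` sites 4 \<union> Vertical ` {..6} \<union> hub_bundle 0"
    by (simp add: bunkbed_arcs_gadget lessThan_Suc)
  have \<Omega>_iff: "X \<in> \<Omega> \<longleftrightarrow> (\<exists>Y\<in>single 4. X = coin ` Y \<union> hub_bundle 0)" for X
  proof
    assume X: "X \<in> \<Omega>"
    let ?Y = "{p \<in> sites 4. coin p \<in> X}"
    have sub: "X \<subseteq> coin ` sites 4 \<union> Vertical ` {..6} \<union> hub_bundle 0"
      using X by (simp add: \<Omega>_def bunkbed)
    have F: "Horizontal s a \<in> X" if "a \<in> ?F" for s a
      using X that by (cases s) (auto simp: \<Omega>_def)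
    have vert: "Vertical v \<in> X \<longleftrightarrow> v \<in> ?T" if "v \<in> {..6} \<union> ?T" for v
      using X that by (simp add: \<Omega>_def verts(1))
    have "X = coin ` ?Y \<union> hub_bundle 0"
    proof (intro equalityI subsetI)
      fix e assume e: "e \<in> X"
      with sub consider p where "p \<in> sites 4" "e = coin p" | v where "v \<le> 6" "e = Vertical v" | "e \<in> hub_bundle 0"
        by blast
      then show "e \<in> coin ` ?Y \<union> hub_bundle 0"
        using e vert verts(2) by cases auto
    next
      fix e assume "e \<in> coin ` ?Y \<union> hub_bundle 0"
      then show "e \<in> X"
        using F vert by (cases e) (auto simp: mem_coin_image mem_hub_bundle hubs_1 coin_def)
    qed
    moreover have "?Y \<in> single 4"
      using X by (auto simp: \<Omega>_def single_def sites_def coin_def arcs)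
    ultimately show "\<exists>Y\<in>single 4. X = coin ` Y \<union> hub_bundle 0" by (rule bexI)
  next
    assume "\<exists>Y\<in>single 4. X = coin ` Y \<union> hub_bundle 0"
    then obtain Y where Y: "Y \<in> single 4" and X: "X = coin ` Y \<union> hub_bundle 0" by blast
    have "Y \<subseteq> sites 4" using Y by (simp add: single_def)
    then have "X \<subseteq> bunkbed_arcs ?D" by (auto simp: X bunkbed)
    moreover have "a \<notin> ?F" if "a \<in> {1..4}" for a using that by (auto simp: bundle_arcs_def)
    ultimately show "X \<in> \<Omega>"
      using Y by (simp add: \<Omega>_def arcs(1)) (simp add: X mem_coin_image mem_hub_bundle hubs_1 single_def)
  qed
  have \<Omega>: "\<Omega> = (\<lambda>Y. coin ` Y \<union> hub_bundle 0) ` single 4"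
    by (rule set_eqI) (simp only: \<Omega>_iff image_iff)
  have disj: "coin ` sites 4 \<inter> hub_bundle 0 = {}"
    by (rule disjoint_bunkbed_arcsI)
      (auto simp: mem_coin_image mem_hub_bundle bundle_arcs_def sites_def)
  have "card {X \<in> \<Omega>. ?ev Lower X} < card {X \<in> \<Omega>. ?ev Upper X}"
  proof (rule card_less_of_single[OF inj_on_coin disj card_single_tied4 \<Omega>])
    show "?ev l (coin ` Y \<union> hub_bundle 0) \<longleftrightarrow> tied4 (joined (levels 4 Y l) (\<lambda>_. False))"
      if "Y \<in> single 4" for Y l
    proof -
      let ?X = "coin ` Y \<union> hub_bundle 0"
      have Y: "Y \<subseteq> sites 4" using that by (simp add: single_def)
      have "coin p \<in> ?X \<longleftrightarrow> p \<in> Y" if "p \<in> sites 4" for p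
        using inj_on_image_mem_iff[OF inj_on_coin that Y] disj that by blast
      then have "{p \<in> sites 4. coin p \<in> ?X} = Y"
        using Y by blast
      moreover have "Vertical v \<notin> ?X" if "v \<le> 6" for v
        using that verts(2) by (auto simp: mem_coin_image mem_hub_bundle hubs_1)
      then have "vertical_links ?X = (\<lambda>_. False)"
        by (simp add: vertical_links_def fun_eq_iff del: Un_iff)
      moreover have "?X \<subseteq> bunkbed_arcs ?D"
        using Y by (auto simp: bunkbed)
      ultimately show ?thesis
        using diconnects_gadget_iff[of ?X "Suc 0" 0 l] by simp
    qed
  qed
  then have "\<P>(X in E6 ?D ?T ?F. diconnects ?D X (0, Lower) (4, Lower))
      < \<P>(X in E6 ?D ?T ?F. diconnects ?D X (0, Lower) (4, Upper))"
    unfolding E6_def \<Omega>_def[symmetric] by (intro prob_less_id) (simp_all add: \<Omega>)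
  moreover have "0 \<in> verts ?D" "4 \<in> verts ?D" "?T \<subseteq> verts ?D" by (auto simp: gadget_def)
  ultimately show ?thesis using digraph_gadget arcs(2) by blast
qed

theorem theorem1p1:
  shows
    "(\<exists>(V :: nat set) E. finite_simple_graph V E \<and> (\<exists>u\<in>V. \<exists>v\<in>V.
        \<P>(X in E1 V E. connects X (u, Lower) (v, Lower))
          < \<P>(X in E1 V E. connects X (u, Lower) (v, Upper))))
   \<and> (\<exists>(V :: nat set) E T. finite_simple_graph V E \<and> T \<subseteq> V \<and> (\<exists>u\<in>V. \<exists>v\<in>V.
        \<P>(X in E2 V E T. connects X (u, Lower) (v, Lower))
          < \<P>(X in E2 V E T. connects X (u, Lower) (v, Upper))))
   \<and> (\<exists>(V :: nat set) E T. finite_hypergraph V E \<and> T \<subseteq> V \<and> (\<exists>u\<in>V. \<exists>v\<in>V.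
        \<P>(X in E4 V E T. connects X (u, Lower) (v, Lower))
          < \<P>(X in E4 V E T. connects X (u, Lower) (v, Upper))))
   \<and> (\<exists>(V :: nat set) E. finite_hypergraph V E \<and> (\<exists>u\<in>V. \<exists>v\<in>V.
        \<P>(X in E5 V E. connects X (u, Lower) (v, Lower))
          < \<P>(X in E5 V E. connects X (u, Lower) (v, Upper))))
   \<and> (\<exists>(D :: (nat, nat) pre_digraph) T F.
        digraph D \<and> T \<subseteq> verts D \<and> F \<subseteq> arcs D \<and> (\<exists>u\<in>verts D. \<exists>v\<in>verts D.
        \<P>(X in E6 D T F. diconnects D X (u, Lower) (v, Lower))
          < \<P>(X in E6 D T F. diconnects D X (u, Lower) (v, Upper))))
   \<and> (\<exists>D :: (nat, nat) pre_digraph. fin_digraph D \<and> (\<exists>u\<in>verts D. \<exists>v\<in>verts D.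
        \<P>(X in E7 D. diconnects D X (u, Lower) (v, Lower))
          < \<P>(X in E7 D. diconnects D X (u, Lower) (v, Upper))))"
  using E1_counterexample E2_counterexample E4_counterexample E5_counterexample
    E6_counterexample E7_counterexample
  by (intro conjI)

end
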